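(* For every Schwartz function $F$ in the variables $(p,q,r,w,p',q',r',w')$ having compact support in $r,w,r',w'$, $$\lim_{\lambda\to0}\left\|\frac{\Psi_\lambda(F)-F}{\lambda}-(-2\pi i)[\psi,F]\right\|_{L^1}=0,$$ where $\Psi_\lambda$ and $[\psi,\cdot]$ are the operators defined in the context.
   Context: Fix an integer $n\ge1$; $p,q,p',q'\in\mathbb R^n$ and $r,w,r',w'\in\mathbb R$. Write $e(t)=e^{2\pi it}$, $\bar e(t)=e^{-2\pi it}$, and for $\lambda\ne0$ $\eta_\lambda(r)=\frac{e^{2\lambda r}-1}{2\lambda}$. The $L^1$-norm is taken with respect to Lebesgue measure in all the variables. $\Psi_\lambda$ (the operator realization of conjugation by the quantum $R$-matrix $R_\lambda$, the function $\bar e[\lambda(rs'+r's)]\,\bar e[2\lambda e^{-\lambda r'}p\cdot q']$) is defined by $$\Psi_\lambda(F)(p,q,r,w,p',q',r',w')=\bar e\bigl[2\lambda e^{-\lambda r}p\cdot q'\bigr]\,e\bigl[2\lambda e^{w-w'-\lambda r}p\cdot q'\bigr]\times$$ $$F\bigl(e^{\lambda r'}p,\ e^{-\lambda r'}q+2\lambda e^{-\lambda r-\lambda r'}\eta_\lambda(r)q',\ r,\ w,\ e^{\lambda r}p'-2\lambda e^{w-w'}\eta_\lambda(r')p,\ e^{-\lambda r}q',\ r',\ w'\bigr).$$ $[\psi,\cdot]$ (the operator realization of the function $\psi=rs'+r's+2p\cdot q'$, corresponding to the classical $r$-matrix $\mathbf z\otimes\mathbf d+\mathbf d\otimes\mathbf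 z+2\sum_i\mathbf{x_i}\otimes\mathbf{y_i}$) is the densely defined operator $$[\psi,F](p,q,r,w,p',q',r',w')=\int\bigl[(r\tilde{\tilde s}+r'\tilde s)+2(p\cdot q'+rq'\cdot\tilde y-e^{w-w'}p\cdot q'-r'e^{w-w'}p\cdot\tilde x)\bigr]\,e[\tilde s\tilde w+\tilde{\tilde s}\tilde{\tilde w}]\,e[\tilde p\cdot\tilde x+\tilde q\cdot\tilde y]\times$$ $$F(e^{\tilde w}p,\ e^{-\tilde w}q+\tilde q,\ r,\ w,\ e^{\tilde{\tilde w}}p'+\tilde p,\ e^{-\tilde{\tilde w}}q',\ r',\ w'),$$ the integration being over all tilde and double-tilde variables $\tilde s,\tilde{\tilde s},\tilde w,\tilde{\tilde w}\in\mathbb R$, $\tilde p,\tilde q,\tilde x,\tilde y\in\mathbb R^n$ (understood as a formal/oscillatory Fourier integral, i.e. through Fourier inversion). *)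

theory Defs
  imports "HOL-Analysis.Analysis"
begin

fun iterated_deriv :: "'a::euclidean_space list \<Rightarrow> ('a \<Rightarrow> 'b::real_normed_vector) \<Rightarrow> 'a \<Rightarrow> 'b" where
  "iterated_deriv [] f = f"
| "iterated_deriv (v # vs) f = (\<lambda>x. frechet_derivative (iterated_deriv vs f) (at x) v)"

text \<open>Partial derivatives of all orders are indexed by lists of coordinate directions;
  (total) differentiability of all of them is smoothness.\<close>

definition schwartz :: "('a::euclidean_space \<Rightarrow> complex) \<Rightarrow> bool" where
  "schwartz f \<longleftrightarrow>
     (\<forall>vs. set vs \<subseteq> Basis \<longrightarrow>
        (\<forall>x. iterated_deriv vs f differentiable (at x)) \<and>
        (\<forall>k::nat. \<exists>C. \<forall>x. (1 + norm x) ^ k * norm (iterated_deriv vs f x) \<le> C))"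

text \<open>The variables are ordered \<open>(p, q, r, w, p', q', r', w')\<close>.\<close>

type_synonym 'n vars =
  "(real ^ 'n) \<times> (real ^ 'n) \<times> real \<times> real \<times> (real ^ 'n) \<times> (real ^ 'n) \<times> real \<times> real"

definition compact_support_rw :: "('n::finite vars \<Rightarrow> complex) \<Rightarrow> bool" where
  "compact_support_rw F \<longleftrightarrow>
     (\<exists>K :: (real \<times> real \<times> real \<times> real) set. compact K \<and>
        (\<forall>p q r w p' q' r' w'. (r, w, r', w') \<notin> K \<longrightarrow> F (p, q, r, w, p', q', r', w') = 0))"

definition e :: "real \<Rightarrow> complex" where
  "e t = exp (2 * pi * \<i> * t)"

definition ebar :: "real \<Rightarrow> complex" where
  "ebar t = exp (- 2 * pi * \<i> * t)"

definition eta :: "real \<Rightarrow> real \<Rightarrow> real" where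
  "eta l r = (exp (2 * l * r) - 1) / (2 * l)"

definition Psi :: "real \<Rightarrow> ('n::finite vars \<Rightarrow> complex) \<Rightarrow> 'n vars \<Rightarrow> complex" where
  "Psi l F = (\<lambda>(p, q, r, w, p', q', r', w').
     ebar (2 * l * exp (- l * r) * (p \<bullet> q')) *
     e (2 * l * exp (w - w' - l * r) * (p \<bullet> q')) *
     F (exp (l * r') *\<^sub>R p,
        exp (- l * r') *\<^sub>R q + (2 * l * exp (- l * r - l * r') * eta l r) *\<^sub>R q',
        r,
        w,
        exp (l * r) *\<^sub>R p' - (2 * l * exp (w - w') * eta l r') *\<^sub>R p,
        exp (- l * r) *\<^sub>R q',
        r',
        w'))"

text \<open>Oscillatory integral over a Euclidean space, by Gaussian regularization: the integral is
  taken with the convergence factor \<open>exp (- \<epsilon> |\<xi>|\<^sup>2)\<close>, and then \<open>\<epsilon> \<rightarrow> 0\<close>. This is the summation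
  method under which Fourier inversion
  \<open>\<integral>\<integral> e (s w) g w dw ds = g 0\<close> and its differentiated form
  \<open>\<integral>\<integral> s e (s w) g w dw ds = - g' 0 / (2 \<pi> \<i>)\<close> hold for bounded measurable \<open>g\<close>
  differentiable at \<open>0\<close>. For integrable integrands it is the ordinary integral.\<close>

definition osc_integral :: "('a::euclidean_space \<Rightarrow> complex) \<Rightarrow> complex" where
  "osc_integral a =
     Lim (at_right 0) (\<lambda>\<epsilon>. \<integral>\<xi>. complex_of_real (exp (- \<epsilon> * (norm \<xi>)\<^sup>2)) * a \<xi> \<partial>lborel)"

text \<open>Below, \<open>s1, w1\<close> are the single-tilde and \<open>s2, w2\<close> the double-tilde variables, and
  \<open>pt, qt, xt, yt\<close> are the tilde variables in \<open>\<real>\<^sup>n\<close>.\<close>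

definition psi_bracket :: "('n::finite vars \<Rightarrow> complex) \<Rightarrow> 'n vars \<Rightarrow> complex" where
  "psi_bracket F = (\<lambda>(p, q, r, w, p', q', r', w').
     osc_integral (\<lambda>(s1 :: real, s2 :: real, w1 :: real, w2 :: real,
         pt :: real ^ 'n, qt :: real ^ 'n, xt :: real ^ 'n, yt :: real ^ 'n).
       complex_of_real
         ((r * s2 + r' * s1) +
          2 * (p \<bullet> q' + r * (q' \<bullet> yt) - exp (w - w') * (p \<bullet> q')
               - r' * exp (w - w') * (p \<bullet> xt))) *
       e (s1 * w1 + s2 * w2) * e (pt \<bullet> xt + qt \<bullet> yt) *
       F (exp w1 *\<^sub>R p, exp (- w1) *\<^sub>R q + qt, r, w,
          exp w2 *\<^sub>R p' + pt, exp (- w2) *\<^sub>R q', r', w')))"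

text \<open>Extended-valued, so that convergence to \<open>0\<close> entails eventual finiteness
  (the Bochner integral would return \<open>0\<close> on non-integrable functions).\<close>

definition L1_norm :: "('a::euclidean_space \<Rightarrow> complex) \<Rightarrow> ennreal" where
  "L1_norm f = (\<integral>\<^sup>+x. ennreal (norm (f x)) \<partial>lborel)"

end

theory Submission
  imports Defs "HOL-Probability.Probability"
begin

text \<open>
  After grouping the integration variables of the bracket into dual pairs, its integrand is an affine
  function of the frequencies times \<open>e (\<sigma> \<bullet> \<omega>)\<close> times a function of the positions \<open>\<omega>\<close>. With the Gaussian
  factor the frequency integral is explicit, and what remains is an approximate identity in \<open>\<omega>\<close>; its
  limit turns \<open>psi_bracket\<close> into a first-order differential operator: multiplication by \<open>psi_phase\<close> plus
  \<open>\<i> / (2 * pi)\<close> times the derivative along the vector field \<open>psi_field\<close>.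

  On the other side \<open>Psi l F\<close> is the pullback of \<open>F\<close> along a smooth family of maps that starts at the
  identity with velocity \<open>psi_field\<close>, multiplied by a smooth phase, so the difference quotients converge
  pointwise. Where \<open>r, w, r', w'\<close> are bounded the maps distort norms by at most a constant factor; hence
  by the mean value theorem the quotients are dominated by an integrable power of \<open>1 / (1 + norm z)\<close>, and
  dominated convergence applies.
\<close>

section \<open>Gaussian integrals\<close>

lemma e_alt: "e t = cis (2 * pi * t)"
  by (simp add: e_def cis_conv_exp algebra_simps)

lemma norm_e [simp]: "norm (e t) = 1"
  by (simp add: e_alt)

lemma e_0 [simp]: "e 0 = 1"
  by (simp add: e_def)

lemma e_add: "e (s + t) = e s * e t"
  by (simp add: e_alt cis_mult algebra_simps)

lemma e_sum: "finite A \<Longrightarrow> e (\<Sum>x\<in>A. f x) = (\<Prod>x\<in>A. e (f x))"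
  by (induction A rule: finite_induct) (simp_all add: e_add)

lemma continuous_on_e [continuous_intros]: "continuous_on S f \<Longrightarrow> continuous_on S (\<lambda>x. e (f x))"
  unfolding e_def by (intro continuous_intros)

lemma measurable_e [measurable]: "e \<in> borel_measurable borel"
  by (intro borel_measurable_continuous_onI continuous_intros)

lemma has_vector_derivative_e:
  "((\<lambda>x. e (x * w)) has_vector_derivative (2 * pi * \<i> * w * e (x * w))) (at x)"
  unfolding e_def
  by (auto intro!: derivative_eq_intros has_vector_derivative_real_field simp: algebra_simps)

section \<open>Gaussian moments and Fourier transforms on the real line\<close>

text \<open>Up to the factor \<open>sqrt (2 * pi * \<sigma>\<^sup>2)\<close>, the integrand is a
  moment integrand of the centered normal density of variance \<open>1 / (2 * c)\<close>.\<close>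

lemma integrable_power_gaussian:
  fixes c :: real
  assumes "c > 0"
  shows "integrable lborel (\<lambda>x::real. x ^ k * exp (- c * x\<^sup>2))"
proof -
  define \<sigma> where "\<sigma> = 1 / sqrt (2 * c)"
  have "\<sigma> > 0" and \<sigma>: "\<sigma>\<^sup>2 = 1 / (2 * c)"
    using assms by (auto simp: \<sigma>_def power_divide)
  have "integrable lborel (\<lambda>x. sqrt (2 * pi * \<sigma>\<^sup>2) * (normal_density 0 \<sigma> x * (x - 0) ^ k))"
    by (intro integrable_mult_right integrable_normal_moment \<open>\<sigma> > 0\<close>)
  also have "(\<lambda>x. sqrt (2 * pi * \<sigma>\<^sup>2) * (normal_density 0 \<sigma> x * (x - 0) ^ k)) = (\<lambda>x. x ^ k * exp (- c * x\<^sup>2))"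
    using assms by (auto simp: normal_density_def \<sigma> field_simps)
  finally show ?thesis .
qed

lemma integrable_power_gaussian_e:
  fixes c :: real
  assumes "c > 0"
  shows "integrable lborel (\<lambda>x::real. complex_of_real (x ^ k * exp (- c * x\<^sup>2)) * e (x * w))"
  by (rule Bochner_Integration.integrable_bound[OF integrable_power_gaussian[OF assms, of k]])
     (auto simp: norm_mult norm_power abs_mult power_abs)

text \<open>The substitution of \<open>a * x\<close> for the variable turns the characteristic
  function of the standard normal distribution into this Fourier transform.\<close>

lemma integral_gaussian_e:
  fixes c :: real
  assumes "c > 0"
  shows "(\<integral>x. complex_of_real (exp (- c * x\<^sup>2)) * e (x * w) \<partial>lborel)
       = complex_of_real (sqrt (pi / c) * exp (- (pi\<^sup>2 * w\<^sup>2 / c)))"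
proof -
  \<comment> \<open>\<open>a\<close> rescales the standard normal density to a multiple of
    \<open>exp (- c * x\<^sup>2)\<close>, and \<open>t\<close> is chosen so that
    \<open>t * (a * x) = 2 * pi * x * w\<close>.\<close>
  define a where "a = sqrt (2 * c)"
  define t where "t = 2 * pi * w / a"
  have a: "a > 0" "a\<^sup>2 = 2 * c"
    using assms by (auto simp: a_def)
  have "complex_of_real (exp (- (t\<^sup>2) / 2)) = char std_normal_distribution t"
    by (simp add: char_std_normal_distribution)
  also have "\<dots> = (\<integral>x. std_normal_density x *\<^sub>R iexp (t * x) \<partial>lborel)"
    unfolding char_def by (subst integral_density) (auto simp: normal_density_nonneg)
  also have "\<dots> = \<bar>a\<bar> *\<^sub>R (\<integral>x. std_normal_density (0 + a * x) *\<^sub>R iexp (t * (0 + a * x)) \<partial>lborel)"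
    by (rule lborel_integral_real_affine) (use a in auto)
  also have "(\<lambda>x. std_normal_density (0 + a * x) *\<^sub>R iexp (t * (0 + a * x)))
      = (\<lambda>x. complex_of_real (1 / sqrt (2 * pi)) * (complex_of_real (exp (- c * x\<^sup>2)) * e (x * w)))"
    using a by (auto simp: std_normal_density_def scaleR_conv_of_real power_mult_distrib t_def e_def algebra_simps)
  finally have "complex_of_real (exp (- (t\<^sup>2) / 2)) = complex_of_real (a / sqrt (2 * pi)) *
      (\<integral>x. complex_of_real (exp (- c * x\<^sup>2)) * e (x * w) \<partial>lborel)"
    using a by (simp add: scaleR_conv_of_real)
  moreover have "t\<^sup>2 / 2 = pi\<^sup>2 * w\<^sup>2 / c"
    using a assms by (simp add: t_def power_divide power_mult_distrib)
  moreover have "sqrt (pi / c) * (a / sqrt (2 * pi)) = 1"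
    using assms by (simp add: a_def real_sqrt_mult real_sqrt_divide)
  ultimately have "complex_of_real (exp (- (pi\<^sup>2 * w\<^sup>2 / c))) = complex_of_real (a / sqrt (2 * pi)) *
      (\<integral>x. complex_of_real (exp (- c * x\<^sup>2)) * e (x * w) \<partial>lborel)"
    by (simp only: minus_divide_left[symmetric])
  then have "complex_of_real (sqrt (pi / c)) * complex_of_real (exp (- (pi\<^sup>2 * w\<^sup>2 / c)))
      = complex_of_real (sqrt (pi / c) * (a / sqrt (2 * pi))) *
      (\<integral>x. complex_of_real (exp (- c * x\<^sup>2)) * e (x * w) \<partial>lborel)"
    by (simp only: of_real_mult mult.assoc)
  then show ?thesis
    by (simp only: \<open>sqrt (pi / c) * (a / sqrt (2 * pi)) = 1\<close> of_real_mult of_real_1 mult_1_left)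
qed

text \<open>The derivative \<open>f'\<close> of the Gaussian times the character integrates to zero
  over the line. It is a combination of the wanted integrand and of \<open>f\<close>, so the
  previous transform determines the result.\<close>

lemma integral_ident_gaussian_e:
  fixes c :: real
  assumes "c > 0"
  shows "(\<integral>x. complex_of_real (x * exp (- c * x\<^sup>2)) * e (x * w) \<partial>lborel)
       = \<i> * pi * w / c * complex_of_real (sqrt (pi / c) * exp (- (pi\<^sup>2 * w\<^sup>2 / c)))"
proof -
  define f where "f = (\<lambda>x. complex_of_real (exp (- c * x\<^sup>2)) * e (x * w))"
  define f' where "f' = (\<lambda>x. (- 2 * c) *\<^sub>R (complex_of_real (x * exp (- c * x\<^sup>2)) * e (x * w)) + 2 * pi * \<i> * w * f x)"
  have i0: "integrable lborel f" and
    i1: "integrable lborel (\<lambda>x. complex_of_real (x * exp (- c * x\<^sup>2)) * e (x * w))"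
    using integrable_power_gaussian_e[OF assms, of 0 w] integrable_power_gaussian_e[OF assms, of 1 w]
    by (simp_all add: f_def)
  have "(f has_vector_derivative f' x) (at x)" for x
    unfolding f_def f'_def
    by (rule derivative_eq_intros has_vector_derivative_e has_vector_derivative_of_real
          has_real_derivative_iff_has_vector_derivative[THEN iffD1] refl)+
       (auto simp: scaleR_conv_of_real algebra_simps)
  moreover have "isCont f' x" for x
    unfolding f'_def f_def e_def by (intro continuous_intros)
  moreover have f': "integrable lborel f'"
    unfolding f'_def using i0 i1 by simp
  have lim: "((\<lambda>x. exp (- c * x\<^sup>2)) \<longlongrightarrow> 0) F"
    if "filterlim (\<lambda>x. x\<^sup>2) at_top F" for F :: "real filter"
    by (rule filterlim_compose[OF exp_at_bot])
       (use filterlim_tendsto_neg_mult_at_bot[OF tendsto_const[of "- c"] _ that] assms in simp)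
  \<comment> \<open>The character has norm 1, so only the decay of the Gaussian matters;
    \<open>lim\<close> covers both ends because it asks only that the square tend to
    infinity.\<close>
  have "(f \<longlongrightarrow> 0) at_bot" "(f \<longlongrightarrow> 0) at_top"
    by (rule tendsto_norm_zero_cancel; simp add: f_def norm_mult;
        use lim[simplified] filterlim_pow_at_top[OF _ filterlim_ident, of 2]
          filterlim_pow_at_bot_even[OF _ filterlim_ident, of 2] in simp)+
  then have "((f \<circ> real_of_ereal) \<longlongrightarrow> 0) (at_right (- \<infinity>))"
    and "((f \<circ> real_of_ereal) \<longlongrightarrow> 0) (at_left \<infinity>)"
    by (simp_all add: ereal_tendsto_simps)
  ultimately have "(LBINT x=-\<infinity>..\<infinity>. f' x) = 0 - 0"
    by (intro interval_integral_FTC_integrable) (auto simp: set_integrable_def f')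
  then have "0 = (\<integral>x. f' x \<partial>lborel)"
    by (simp add: interval_lebesgue_integral_def set_lebesgue_integral_def)
  also have "\<dots> = (- 2 * c) *\<^sub>R (\<integral>x. complex_of_real (x * exp (- c * x\<^sup>2)) * e (x * w) \<partial>lborel) + 2 * pi * \<i> * w * (\<integral>x. f x \<partial>lborel)"
    unfolding f'_def using i0 i1 by simp
  finally show ?thesis
    using assms unfolding f_def integral_gaussian_e[OF assms] by (simp add: scaleR_conv_of_real field_simps)
qed

section \<open>Gaussian integrals on Euclidean space\<close>

text \<open>Lebesgue measure is the image of the product of one-dimensional Lebesgue measures under
  the coordinate map, so integrals of products separate.\<close>

lemma lborel_prod_Basis:
  fixes h :: "'a::euclidean_space \<Rightarrow> real \<Rightarrow> 'c::{real_normed_field,banach,second_countable_topology}"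
  assumes h: "\<And>b. b \<in> Basis \<Longrightarrow> integrable lborel (h b)"
  shows integrable_lborel_prod_Basis: "integrable lborel (\<lambda>x. \<Prod>b\<in>Basis. h b (x \<bullet> b))"
    and integral_lborel_prod_Basis:
      "(\<integral>x. (\<Prod>b\<in>Basis. h b (x \<bullet> b)) \<partial>lborel) = (\<Prod>b\<in>Basis. \<integral>t. h b t \<partial>lborel)"
proof -
  interpret product_sigma_finite "\<lambda>_::'a. lborel :: real measure"
    by standard
  have [measurable]: "h b \<in> borel_measurable borel" if "b \<in> Basis" for b
    using h[OF that] by (simp add: borel_measurable_integrable)
  have *: "(\<Prod>b\<in>Basis. h b ((\<Sum>b\<in>Basis. f b *\<^sub>R b) \<bullet> b)) = (\<Prod>b\<in>Basis. h b (f b))" for f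
    by (intro prod.cong) auto
  show "integrable lborel (\<lambda>x. \<Prod>b\<in>Basis. h b (x \<bullet> b))"
    unfolding lborel_eq[where 'a='a]
    by (subst integrable_distr_eq) (simp_all add: * product_integrable_prod h)
  show "(\<integral>x. (\<Prod>b\<in>Basis. h b (x \<bullet> b)) \<partial>lborel) = (\<Prod>b\<in>Basis. \<integral>t. h b t \<partial>lborel)"
    unfolding lborel_eq[where 'a='a]
    by (subst integral_distr) (simp_all add: * product_integral_prod h)
qed

lemma exp_norm_eq_prod:
  "exp (- c * (norm x)\<^sup>2) = (\<Prod>b\<in>Basis. exp (- c * (x \<bullet> b)\<^sup>2))" for x :: "'a::euclidean_space"
proof -
  have "(norm x)\<^sup>2 = (\<Sum>b\<in>Basis. (x \<bullet> b)\<^sup>2)"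
    using euclidean_inner[of x x] unfolding power2_norm_eq_inner by (simp only: power2_eq_square)
  then show ?thesis
    by (simp add: sum_distrib_left exp_sum flip: sum_negf)
qed

text \<open>The variant in the form \<open>- (c * x)\<close>, to which the simplifier brings the
  exponent.\<close>

lemmas exp_norm_eq_prod' = exp_norm_eq_prod[unfolded mult_minus_left]

lemma e_inner_eq_prod: "e (x \<bullet> w) = (\<Prod>b\<in>Basis. e ((x \<bullet> b) * (w \<bullet> b)))"
  for x :: "'a::euclidean_space"
  by (simp add: euclidean_inner[of x w] e_sum)

text \<open>Serves to write a single coordinate factor as a product over all coordinates, so that a
  monomial times a Gaussian separates.\<close>

lemma prod_power_indicator:
  fixes f :: "'a \<Rightarrow> 'b::comm_monoid_mult"
  assumes "finite A" "a \<in> A"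
  shows "(\<Prod>i\<in>A. f i ^ (if i = a then k else 0)) = f a ^ k"
proof -
  have "(\<Prod>i\<in>A. f i ^ (if i = a then k else 0)) = (\<Prod>i\<in>A. if i = a then f i ^ k else 1)"
    by (intro prod.cong) auto
  then show ?thesis
    using assms by simp
qed

text \<open>The exponent \<open>k i\<close> counts how often \<open>i\<close> occurs among
  \<open>b\<close> and \<open>b'\<close>, which treats equal and distinct coordinates alike.\<close>

lemma integrable_coord2_gaussian:
  fixes c :: real
  assumes "c > 0" "b \<in> Basis" "b' \<in> Basis"
  shows "integrable lborel (\<lambda>x::'a::euclidean_space. (x \<bullet> b) * (x \<bullet> b') * exp (- c * (norm x)\<^sup>2))"
proof -
  define k where "k i = (if i = b then 1 else 0) + (if i = b' then 1 else 0 :: nat)" for i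
  have "integrable lborel (\<lambda>x::'a. \<Prod>i\<in>Basis. (x \<bullet> i) ^ k i * exp (- c * (x \<bullet> i)\<^sup>2))"
    by (intro integrable_lborel_prod_Basis integrable_power_gaussian assms)
  also have "(\<lambda>x::'a. \<Prod>i\<in>Basis. (x \<bullet> i) ^ k i * exp (- c * (x \<bullet> i)\<^sup>2))
      = (\<lambda>x. (x \<bullet> b) * (x \<bullet> b') * exp (- c * (norm x)\<^sup>2))"
    using assms by (simp add: k_def power_add prod.distrib prod_power_indicator exp_norm_eq_prod')
  finally show ?thesis .
qed

lemma integrable_gaussian:
  fixes c :: real
  assumes "c > 0"
  shows "integrable lborel (\<lambda>x::'a::euclidean_space. exp (- c * (norm x)\<^sup>2))"
  using integrable_lborel_prod_Basis[where 'a='a, of "\<lambda>_ x. exp (- c * x\<^sup>2)"]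
    integrable_power_gaussian[OF assms, of 0]
  by (simp only: exp_norm_eq_prod) simp

lemma integrable_norm2_gaussian:
  fixes c :: real
  assumes "c > 0"
  shows "integrable lborel (\<lambda>x::'a::euclidean_space. (norm x)\<^sup>2 * exp (- c * (norm x)\<^sup>2))"
proof -
  have "integrable lborel (\<lambda>x::'a. \<Sum>b\<in>Basis. (x \<bullet> b) * (x \<bullet> b) * exp (- c * (norm x)\<^sup>2))"
    by (intro Bochner_Integration.integrable_sum integrable_coord2_gaussian assms)
  also have "(\<lambda>x::'a. \<Sum>b\<in>Basis. (x \<bullet> b) * (x \<bullet> b) * exp (- c * (norm x)\<^sup>2))
      = (\<lambda>x. (norm x)\<^sup>2 * exp (- c * (norm x)\<^sup>2))"
    by (simp add: power2_norm_eq_inner euclidean_inner[of x x for x] sum_distrib_right)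
  finally show ?thesis .
qed

lemma integrable_norm_gaussian:
  fixes c :: real
  assumes "c > 0"
  shows "integrable lborel (\<lambda>x::'a::euclidean_space. norm x * exp (- c * (norm x)\<^sup>2))"
proof (rule Bochner_Integration.integrable_bound)
  show "integrable lborel (\<lambda>x::'a. exp (- c * (norm x)\<^sup>2) + (norm x)\<^sup>2 * exp (- c * (norm x)\<^sup>2))"
    by (intro Bochner_Integration.integrable_add integrable_gaussian integrable_norm2_gaussian assms)
  have "norm x * exp (- c * (norm x)\<^sup>2) \<le> (1 + (norm x)\<^sup>2) * exp (- c * (norm x)\<^sup>2)" for x :: 'a
  proof (rule mult_right_mono)
    show "norm x \<le> 1 + (norm x)\<^sup>2"
      using sum_squares_bound[of 1 "norm x"] norm_ge_zero[of x] unfolding one_power2 by linarith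
  qed simp
  then show "AE x::'a in lborel. norm (norm x * exp (- c * (norm x)\<^sup>2))
      \<le> norm (exp (- c * (norm x)\<^sup>2) + (norm x)\<^sup>2 * exp (- c * (norm x)\<^sup>2))"
    by (simp add: distrib_right)
qed simp

text \<open>After separation, distinct coordinates contribute a vanishing first moment, and equal
  ones the second moment, that is, the variance \<open>1 / (2 * c)\<close> times the total
  mass.\<close>

lemma integral_coord2_gaussian:
  fixes c :: real
  assumes "c > 0" "b \<in> Basis" "b' \<in> Basis"
  shows "(\<integral>(x::'a::euclidean_space). (x \<bullet> b) * (x \<bullet> b') * exp (- c * (norm x)\<^sup>2) \<partial>lborel)
       = sqrt (pi / c) ^ DIM('a) * (if b = b' then 1 / (2 * c) else 0)"
proof -
  define k where "k i = (if i = b then 1 else 0) + (if i = b' then 1 else 0 :: nat)" for i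
  define m where "m j = (\<integral>x. x ^ j * exp (- c * x\<^sup>2) \<partial>lborel)" for j :: nat
  define \<sigma> where "\<sigma> = 1 / sqrt (2 * c)"
  have \<sigma>: "\<sigma> > 0" "\<sigma>\<^sup>2 = 1 / (2 * c)"
    using assms by (auto simp: \<sigma>_def power_divide)
  have m: "m j = sqrt (pi / c) * (\<integral>x. normal_density 0 \<sigma> x * (x - 0) ^ j \<partial>lborel)" for j
  proof -
    have "x ^ j * exp (- c * x\<^sup>2) = sqrt (pi / c) * (normal_density 0 \<sigma> x * (x - 0) ^ j)" for x
      using assms by (auto simp: normal_density_def \<sigma> field_simps)
    then show ?thesis
      by (simp only: m_def integral_mult_right_zero)
  qed
  have m0: "m 0 = sqrt (pi / c)" and m1: "m 1 = 0" and m2: "m 2 = sqrt (pi / c) * (1 / (2 * c))"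
    using integral_normal_moment_even[OF \<sigma>(1), of 0 0] integral_normal_moment_odd[OF \<sigma>(1), of 0 0]
      integral_normal_moment_even[OF \<sigma>(1), of 0 1]
    by (simp_all add: m \<sigma>)
  have "(\<integral>(x::'a). (x \<bullet> b) * (x \<bullet> b') * exp (- c * (norm x)\<^sup>2) \<partial>lborel)
      = (\<integral>(x::'a). (\<Prod>i\<in>Basis. (x \<bullet> i) ^ k i * exp (- c * (x \<bullet> i)\<^sup>2)) \<partial>lborel)"
    using assms by (simp add: k_def power_add prod.distrib prod_power_indicator exp_norm_eq_prod')
  also have "\<dots> = (\<Prod>i\<in>Basis. m (k i))"
    unfolding m_def by (intro integral_lborel_prod_Basis integrable_power_gaussian assms)
  also have "\<dots> = sqrt (pi / c) ^ DIM('a) * (if b = b' then 1 / (2 * c) else 0)"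
  proof (cases "b = b'")
    case True
    then have "(\<Prod>i\<in>Basis. m (k i)) = (\<Prod>i\<in>Basis. sqrt (pi / c) * (if i = b then 1 / (2 * c) else 1))"
      using m0 m2 by (intro prod.cong) (auto simp: k_def numeral_2_eq_2)
    then show ?thesis
      using True assms by (simp add: prod.distrib)
  next
    case False
    then have "k b = 1"
      by (simp add: k_def)
    then have "(\<Prod>i\<in>Basis. m (k i)) = 0"
      using m1 assms by (intro prod_zero bexI[of _ b]) auto
    then show ?thesis
      using False by simp
  qed
  finally show ?thesis .
qed

lemma integral_gaussian_e_Basis:
  fixes c :: real
  assumes "c > 0"
  shows "(\<integral>(x::'a::euclidean_space). complex_of_real (exp (- c * (norm x)\<^sup>2)) * e (x \<bullet> w) \<partial>lborel)
      = complex_of_real (sqrt (pi / c) ^ DIM('a) * exp (- (pi\<^sup>2 / c) * (norm w)\<^sup>2))"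
proof -
  have "(\<integral>(x::'a). complex_of_real (exp (- c * (norm x)\<^sup>2)) * e (x \<bullet> w) \<partial>lborel)
      = (\<integral>(x::'a). (\<Prod>i\<in>Basis. complex_of_real (exp (- c * (x \<bullet> i)\<^sup>2)) * e ((x \<bullet> i) * (w \<bullet> i))) \<partial>lborel)"
    by (simp only: exp_norm_eq_prod e_inner_eq_prod prod.distrib of_real_prod)
  also have "\<dots> = (\<Prod>i\<in>Basis. \<integral>t. complex_of_real (exp (- c * t\<^sup>2)) * e (t * (w \<bullet> i)) \<partial>lborel)"
    using integrable_power_gaussian_e[OF assms, of 0] by (intro integral_lborel_prod_Basis) simp
  also have "\<dots> = complex_of_real (\<Prod>i\<in>Basis. sqrt (pi / c) * exp (- (pi\<^sup>2 / c) * (w \<bullet> i)\<^sup>2))"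
    by (simp only: integral_gaussian_e[OF assms] of_real_prod) simp
  also have "\<dots> = complex_of_real (sqrt (pi / c) ^ DIM('a) * exp (- (pi\<^sup>2 / c) * (norm w)\<^sup>2))"
    by (simp only: prod.distrib exp_norm_eq_prod prod_constant)
  finally show ?thesis .
qed

text \<open>In the separated product, coordinate \<open>b\<close> contributes the first-moment
  transform and every other coordinate the plain Gaussian transform; the extra factor is collected
  by \<open>prod.delta\<close>.\<close>

lemma integral_coord_gaussian_e_Basis:
  fixes c :: real
  assumes "c > 0" "b \<in> Basis"
  shows "(\<integral>(x::'a::euclidean_space). (x \<bullet> b) *\<^sub>R (complex_of_real (exp (- c * (norm x)\<^sup>2)) * e (x \<bullet> w)) \<partial>lborel)
      = \<i> * pi * (w \<bullet> b) / c * complex_of_real (sqrt (pi / c) ^ DIM('a) * exp (- (pi\<^sup>2 / c) * (norm w)\<^sup>2))"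
proof -
  define k where "k i = (if i = b then 1 else 0 :: nat)" for i
  have "(\<integral>(x::'a). (x \<bullet> b) *\<^sub>R (complex_of_real (exp (- c * (norm x)\<^sup>2)) * e (x \<bullet> w)) \<partial>lborel)
      = (\<integral>(x::'a). (\<Prod>i\<in>Basis. complex_of_real ((x \<bullet> i) ^ k i * exp (- c * (x \<bullet> i)\<^sup>2)) * e ((x \<bullet> i) * (w \<bullet> i))) \<partial>lborel)"
    using assms(2) by (simp add: exp_norm_eq_prod' e_inner_eq_prod prod.distrib k_def
        prod_power_indicator scaleR_conv_of_real mult.assoc flip: of_real_prod)
  also have "\<dots> = (\<Prod>i\<in>Basis. \<integral>t. complex_of_real (t ^ k i * exp (- c * t\<^sup>2)) * e (t * (w \<bullet> i)) \<partial>lborel)"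
    by (intro integral_lborel_prod_Basis integrable_power_gaussian_e assms)
  also have "\<dots> = (\<Prod>i\<in>Basis. (if i = b then \<i> * pi * (w \<bullet> b) / c else 1) *
      complex_of_real (sqrt (pi / c) * exp (- (pi\<^sup>2 / c) * (w \<bullet> i)\<^sup>2)))"
    using integral_gaussian_e[OF assms(1)] integral_ident_gaussian_e[OF assms(1)]
    by (intro prod.cong) (auto simp: k_def)
  also have "\<dots> = (\<Prod>i\<in>Basis. if i = b then \<i> * pi * (w \<bullet> b) / c else 1) *
      complex_of_real (\<Prod>i\<in>Basis. sqrt (pi / c) * exp (- (pi\<^sup>2 / c) * (w \<bullet> i)\<^sup>2))"
    by (subst prod.distrib) (simp only: of_real_prod)
  also have "\<dots> = \<i> * pi * (w \<bullet> b) / c * complex_of_real (sqrt (pi / c) ^ DIM('a) * exp (- (pi\<^sup>2 / c) * (norm w)\<^sup>2))"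
    using assms(2) by (subst prod.delta) (simp_all only: exp_norm_eq_prod prod.distrib prod_constant finite_Basis if_True)
  finally show ?thesis .
qed

lemma integrable_gaussian_e:
  fixes c :: real
  assumes "c > 0"
  shows "integrable lborel (\<lambda>x::'a::euclidean_space. complex_of_real (exp (- c * (norm x)\<^sup>2)) * e (x \<bullet> w))"
    and "integrable lborel (\<lambda>x::'a. (x \<bullet> L) *\<^sub>R (complex_of_real (exp (- c * (norm x)\<^sup>2)) * e (x \<bullet> w)))"
proof -
  show "integrable lborel (\<lambda>x::'a. complex_of_real (exp (- c * (norm x)\<^sup>2)) * e (x \<bullet> w))"
    by (rule Bochner_Integration.integrable_bound[OF integrable_gaussian[OF assms]]) (auto simp: norm_mult)
  show "integrable lborel (\<lambda>x::'a. (x \<bullet> L) *\<^sub>R (complex_of_real (exp (- c * (norm x)\<^sup>2)) * e (x \<bullet> w)))"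
  proof (rule Bochner_Integration.integrable_bound)
    show "integrable lborel (\<lambda>x::'a. norm x * exp (- c * (norm x)\<^sup>2) * norm L)"
      by (intro integrable_mult_left integrable_norm_gaussian assms)
    have "\<bar>x \<bullet> L\<bar> * exp (- c * (norm x)\<^sup>2) \<le> norm x * exp (- c * (norm x)\<^sup>2) * norm L" for x
      using mult_right_mono[OF Cauchy_Schwarz_ineq2[of x L], of "exp (- c * (norm x)\<^sup>2)"]
      by (simp add: mult_ac)
    then show "AE x::'a in lborel. norm ((x \<bullet> L) *\<^sub>R (complex_of_real (exp (- c * (norm x)\<^sup>2)) * e (x \<bullet> w)))
        \<le> norm (norm x * exp (- c * (norm x)\<^sup>2) * norm L)"
      by (simp add: norm_mult)
  qed simp
qed

text \<open>This is the whole frequency integral of the bracket at a fixed position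
  \<open>w\<close>: expanding \<open>L\<close> in the basis reduces its linear part to single
  coordinates.\<close>

lemma integral_affine_gaussian_e:
  fixes c a :: real
  assumes "c > 0"
  shows "(\<integral>(x::'a::euclidean_space). complex_of_real (exp (- c * (norm x)\<^sup>2)) * (complex_of_real (a + x \<bullet> L) * e (x \<bullet> w)) \<partial>lborel)
      = (a + \<i> * pi * (w \<bullet> L) / c) * complex_of_real (sqrt (pi / c) ^ DIM('a) * exp (- (pi\<^sup>2 / c) * (norm w)\<^sup>2))"
proof -
  define g where "g x = complex_of_real (exp (- c * (norm x)\<^sup>2)) * e (x \<bullet> w)" for x :: 'a
  define A where "A = complex_of_real (sqrt (pi / c) ^ DIM('a) * exp (- (pi\<^sup>2 / c) * (norm w)\<^sup>2))"
  note int = integrable_gaussian_e(1)[OF assms, of w, folded g_def]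
    integrable_gaussian_e(2)[OF assms, of _ w, folded g_def]
  have "(\<integral>x. (x \<bullet> L) *\<^sub>R g x \<partial>lborel) = (\<integral>x. (\<Sum>b\<in>Basis. (L \<bullet> b) *\<^sub>R (x \<bullet> b) *\<^sub>R g x) \<partial>lborel)"
    by (simp add: euclidean_inner[of x L for x] scaleR_sum_left mult.commute)
  also have "\<dots> = (\<Sum>b\<in>Basis. (L \<bullet> b) *\<^sub>R (\<i> * pi * (w \<bullet> b) / c * A))"
    using int by (subst Bochner_Integration.integral_sum)
      (simp_all add: integral_coord_gaussian_e_Basis[OF assms, of _ w, folded g_def A_def] del: scaleR_scaleR)
  also have "\<dots> = \<i> * pi * (w \<bullet> L) / c * A"
    by (simp add: euclidean_inner[of w L] sum_distrib_left sum_distrib_right sum_divide_distrib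
        scaleR_conv_of_real algebra_simps)
  finally have L: "(\<integral>x. (x \<bullet> L) *\<^sub>R g x \<partial>lborel) = \<i> * pi * (w \<bullet> L) / c * A" .
  have "(\<integral>(x::'a). complex_of_real (exp (- c * (norm x)\<^sup>2)) * (complex_of_real (a + x \<bullet> L) * e (x \<bullet> w)) \<partial>lborel)
      = (\<integral>x. a *\<^sub>R g x + (x \<bullet> L) *\<^sub>R g x \<partial>lborel)"
    by (simp add: g_def scaleR_conv_of_real algebra_simps)
  also have "\<dots> = a *\<^sub>R (\<integral>x. g x \<partial>lborel) + (\<integral>x. (x \<bullet> L) *\<^sub>R g x \<partial>lborel)"
    using int by simp
  also have "(\<integral>x. g x \<partial>lborel) = A"
    unfolding g_def A_def by (rule integral_gaussian_e_Basis[OF assms])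
  also have "a *\<^sub>R A + (\<integral>x. (x \<bullet> L) *\<^sub>R g x \<partial>lborel) = (a + \<i> * pi * (w \<bullet> L) / c) * A"
    by (simp only: L) (simp add: scaleR_conv_of_real algebra_simps)
  finally show ?thesis
    unfolding A_def .
qed

text \<open>The matrix of second moments of an isotropic Gaussian is a multiple of the identity, so
  pairing \<open>x \<bullet> L\<close> with \<open>D x\<close> evaluates \<open>D\<close> at
  \<open>L\<close>.\<close>

lemma integral_inner_linear_gaussian:
  fixes D :: "'a::euclidean_space \<Rightarrow> complex" and c :: real
  assumes "linear D" "c > 0"
  shows "(\<integral>x. (exp (- c * (norm x)\<^sup>2) * (x \<bullet> L)) *\<^sub>R D x \<partial>lborel) = (sqrt (pi / c) ^ DIM('a) / (2 * c)) *\<^sub>R D L"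
proof -
  interpret linear D by fact
  define g where "g = (\<lambda>x::'a. exp (- c * (norm x)\<^sup>2))"
  have D: "D x = (\<Sum>b\<in>Basis. (x \<bullet> b) *\<^sub>R D b)" for x
    by (subst euclidean_representation[symmetric, of x]) (simp add: sum scale)
  have "(g x * (x \<bullet> L)) *\<^sub>R D x
      = (\<Sum>b\<in>Basis. \<Sum>b'\<in>Basis. ((x \<bullet> b) * (x \<bullet> b') * g x) *\<^sub>R ((L \<bullet> b) *\<^sub>R D b'))" for x
  proof -
    have "(g x * (x \<bullet> L)) *\<^sub>R D x = (\<Sum>b\<in>Basis. (g x * ((x \<bullet> b) * (L \<bullet> b))) *\<^sub>R D x)"
      by (simp only: euclidean_inner[of x L] sum_distrib_left scaleR_sum_left)
    also have "\<dots> = (\<Sum>b\<in>Basis. \<Sum>b'\<in>Basis. ((x \<bullet> b) * (x \<bullet> b') * g x) *\<^sub>R ((L \<bullet> b) *\<^sub>R D b'))"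
      by (subst D) (simp add: scaleR_sum_right ac_simps)
    finally show ?thesis .
  qed
  moreover have int: "integrable lborel (\<lambda>x. ((x \<bullet> b) * (x \<bullet> b') * g x) *\<^sub>R v)"
    if "b \<in> Basis" "b' \<in> Basis" for b b' :: 'a and v :: complex
    using integrable_coord2_gaussian[OF assms(2) that] by (auto simp: g_def)
  ultimately have "(\<integral>x. (g x * (x \<bullet> L)) *\<^sub>R D x \<partial>lborel)
      = (\<integral>x. (\<Sum>b\<in>Basis. \<Sum>b'\<in>Basis. ((x \<bullet> b) * (x \<bullet> b') * g x) *\<^sub>R ((L \<bullet> b) *\<^sub>R D b')) \<partial>lborel)"
    by simp
  also have "\<dots> = (\<Sum>b\<in>Basis. \<integral>x. (\<Sum>b'\<in>Basis. ((x \<bullet> b) * (x \<bullet> b') * g x) *\<^sub>R ((L \<bullet> b) *\<^sub>R D b')) \<partial>lborel)"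
    by (intro Bochner_Integration.integral_sum Bochner_Integration.integrable_sum int)
  also have "\<dots> = (\<Sum>b\<in>Basis. \<Sum>b'\<in>Basis. \<integral>x. ((x \<bullet> b) * (x \<bullet> b') * g x) *\<^sub>R ((L \<bullet> b) *\<^sub>R D b') \<partial>lborel)"
    by (intro sum.cong refl Bochner_Integration.integral_sum int)
  also have "\<dots> = (\<Sum>b\<in>Basis. \<Sum>b'\<in>Basis. (\<integral>x. (x \<bullet> b) * (x \<bullet> b') * g x \<partial>lborel) *\<^sub>R ((L \<bullet> b) *\<^sub>R D b'))"
    by (intro sum.cong refl integral_scaleR_left) (use integrable_coord2_gaussian[OF assms(2)] in \<open>auto simp: g_def\<close>)
  also have "\<dots> = (\<Sum>b\<in>Basis. \<Sum>b'\<in>Basis. if b = b' then (sqrt (pi / c) ^ DIM('a) / (2 * c)) *\<^sub>R (L \<bullet> b) *\<^sub>R D b' else 0)"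
    unfolding g_def using assms(2) by (intro sum.cong refl) (simp add: integral_coord2_gaussian[OF assms(2), unfolded mult_minus_left])
  also have "\<dots> = (sqrt (pi / c) ^ DIM('a) / (2 * c)) *\<^sub>R D L"
    by (subst (2) D) (simp add: scaleR_sum_right)
  finally show ?thesis
    by (simp add: g_def)
qed

section \<open>Gaussian regularization of the Fourier inversion formula\<close>

lemma lborel_integral_scaleR:
  fixes f :: "'a::euclidean_space \<Rightarrow> 'b::{banach,second_countable_topology}"
  assumes [measurable]: "f \<in> borel_measurable borel" and "c \<noteq> 0"
  shows "(\<integral>x. f x \<partial>lborel) = \<bar>c\<bar> ^ DIM('a) *\<^sub>R (\<integral>x. f (c *\<^sub>R x) \<partial>lborel)"
proof -
  have "(\<integral>x. f x \<partial>lborel) = (\<integral>x. f x \<partial>density (distr lborel borel (\<lambda>x. 0 + c *\<^sub>R x)) (\<lambda>_. ennreal (\<bar>c\<bar> ^ DIM('a))))"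
    by (subst lborel_affine[OF assms(2), of 0]) (simp add: ennreal_power)
  then show ?thesis
    by (simp add: integral_density integral_distr)
qed

text \<open>Inside a ball of radius \<open>d\<close> differentiability gives the slope
  \<open>1 + K\<close>; outside it the difference is at most \<open>2 * M\<close>, hence at most
  \<open>2 * M / d * norm v\<close>. The result provides a dominating function for the difference
  quotients.\<close>

lemma bounded_differentiable_lipschitz_at_0:
  fixes G :: "'a::real_normed_vector \<Rightarrow> 'b::real_normed_vector"
  assumes bdd: "\<And>v. norm (G v) \<le> M" and D: "(G has_derivative D) (at 0)"
  obtains C where "C \<ge> 0" "\<And>v. norm (G v - G 0) \<le> C * norm v"
proof -
  interpret D: bounded_linear D
    using D by (rule has_derivative_bounded_linear)
  obtain K where K: "K > 0" "\<And>v. norm (D v) \<le> norm v * K"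
    using D.pos_bounded by blast
  obtain d where d: "d > 0" "\<And>v. norm v < d \<Longrightarrow> norm (G v - G 0 - D v) \<le> norm v"
    using D unfolding has_derivative_at_alt by (metis diff_zero mult_1 zero_less_one)
  have M: "M \<ge> 0"
    using bdd[of 0] norm_ge_zero[of "G 0"] by linarith
  show ?thesis
  proof (rule that[of "1 + K + 2 * M / d"])
    show "norm (G v - G 0) \<le> (1 + K + 2 * M / d) * norm v" for v
    proof (cases "norm v < d")
      case True
      have "norm (G v - G 0) \<le> norm (G v - G 0 - D v) + norm (D v)"
        by (metis diff_add_cancel norm_triangle_ineq)
      also have "\<dots> \<le> (1 + K) * norm v"
        using d(2)[OF True] K(2)[of v] by (simp add: algebra_simps)
      also have "\<dots> \<le> (1 + K + 2 * M / d) * norm v"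
        using M d(1) by (intro mult_right_mono) auto
      finally show ?thesis .
    next
      case False
      have "norm (G v - G 0) \<le> 2 * M"
        using norm_triangle_ineq4[of "G v" "G 0"] bdd[of v] bdd[of 0] by linarith
      also have "\<dots> \<le> 2 * M / d * norm v"
        using False M d(1) by (simp add: field_simps mult_left_mono)
      also have "\<dots> \<le> (1 + K + 2 * M / d) * norm v"
        using K(1) by (intro mult_right_mono) auto
      finally show ?thesis .
    qed
  qed (use K d M in auto)
qed

text \<open>The sequential form of a directional derivative, as dominated convergence requires; it
  applies both to the regularized integral and to the quotients of \<open>Psi\<close>.\<close>

lemma has_derivative_scaled_quotient_tendsto:
  assumes "(G has_derivative D) (at 0)" and "X \<longlonglongrightarrow> 0" and "\<And>n. X n \<noteq> (0::real)"
  shows "(\<lambda>n. (G (X n *\<^sub>R u) - G 0) /\<^sub>R X n) \<longlonglongrightarrow> D u"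
proof -
  have lin: "D (t *\<^sub>R u) = t *\<^sub>R D u" for t
    using has_derivative_linear[OF assms(1)] by (rule linear_cmul)
  have "((\<lambda>t. G (t *\<^sub>R u)) has_derivative (\<lambda>t. D (t *\<^sub>R u))) (at 0)"
    by (rule has_derivative_compose[where g = G and f = "\<lambda>t. t *\<^sub>R u"])
       (auto intro!: derivative_eq_intros assms(1)[THEN has_derivative_eq_rhs])
  then have "((\<lambda>t. norm (G (t *\<^sub>R u) - G 0 - t *\<^sub>R D u) / norm t) \<longlongrightarrow> 0) (at 0)"
    by (simp add: has_derivative_at lin)
  moreover have "norm (G (t *\<^sub>R u) - G 0 - t *\<^sub>R D u) / norm t = norm ((G (t *\<^sub>R u) - G 0) /\<^sub>R t - D u)"
    if "t \<noteq> 0" for t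
  proof -
    have "(G (t *\<^sub>R u) - G 0) /\<^sub>R t - D u = (G (t *\<^sub>R u) - G 0 - t *\<^sub>R D u) /\<^sub>R t"
      using that by (simp add: scaleR_diff_right)
    then show ?thesis
      by (simp only: norm_scaleR) (simp add: divide_inverse mult.commute)
  qed
  ultimately have "((\<lambda>t. norm ((G (t *\<^sub>R u) - G 0) /\<^sub>R t - D u)) \<longlongrightarrow> 0) (at 0)"
    by (auto elim!: Lim_transform_eventually simp: eventually_at_filter)
  then have "((\<lambda>t. (G (t *\<^sub>R u) - G 0) /\<^sub>R t) \<longlongrightarrow> D u) (at 0)"
    by (rule LIM_zero_cancel[OF tendsto_norm_zero_cancel])
  then show ?thesis
    using assms(2,3) by (auto simp: tendsto_at_iff_sequentially o_def)
qed

text \<open>Integrating out the frequencies leaves a Gaussian in the position whose width is of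
  order \<open>sqrt \<epsilon>\<close>. The constant \<open>a\<close> thus picks out
  \<open>G 0\<close>. The linear term produces an odd factor of order
  \<open>1 / sqrt \<epsilon>\<close>, which sees only the first-order part of \<open>G\<close> at
  the origin, and the second moments turn that part into \<open>D L\<close>.\<close>

lemma tendsto_gaussian_regularization:
  fixes G :: "'a::euclidean_space \<Rightarrow> complex" and a :: real
  assumes meas [measurable]: "G \<in> borel_measurable borel"
    and bdd: "\<And>v. norm (G v) \<le> M" and D: "(G has_derivative D) (at 0)"
  shows "((\<lambda>\<epsilon>. \<integral>\<xi>. complex_of_real (exp (- \<epsilon> * (norm \<xi>)\<^sup>2)) *
             (complex_of_real (a + fst \<xi> \<bullet> L) * e (fst \<xi> \<bullet> snd \<xi>) * G (snd \<xi>)) \<partial>(lborel :: ('a \<times> 'a) measure))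
    \<longlongrightarrow> a * G 0 + \<i> / (2 * pi) * D L) (at_right 0)"
proof -
  obtain C where C: "C \<ge> 0" "\<And>v. norm (G v - G 0) \<le> C * norm v"
    using bounded_differentiable_lipschitz_at_0[OF bdd D] by blast
  have M: "M \<ge> 0"
    using bdd[of 0] norm_ge_zero[of "G 0"] by linarith
  define I where "I \<epsilon> = (\<integral>\<xi>. complex_of_real (exp (- \<epsilon> * (norm \<xi>)\<^sup>2)) *
      (complex_of_real (a + fst \<xi> \<bullet> L) * e (fst \<xi> \<bullet> snd \<xi>) * G (snd \<xi>)) \<partial>(lborel :: ('a \<times> 'a) measure))" for \<epsilon>
  \<comment> \<open>Integrating out the frequencies and substituting \<open>s *\<^sub>R u\<close>, \<open>s = sqrt \<epsilon>\<close>, for the position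
    leaves \<open>sqrt pi ^ n\<close> times \<open>\<integral> h s u\<close>; subtracting \<open>G 0\<close> is free because the Gaussian is even.\<close>
  define h where "h s u = exp (- (s ^ 4 + pi\<^sup>2) * (norm u)\<^sup>2) *\<^sub>R
      (a * G (s *\<^sub>R u) + \<i> * pi * (u \<bullet> L) * ((G (s *\<^sub>R u) - G 0) /\<^sub>R s))" for s and u :: 'a
  \<comment> \<open>A majorant of \<open>h s\<close> uniform in \<open>s\<close>: the term
    \<open>s ^ 4\<close> is dropped from the exponent and the difference quotient is replaced by the
    bound \<open>C * norm u\<close>.\<close>
  define W where "W u = \<bar>a\<bar> * M * exp (- pi\<^sup>2 * (norm u)\<^sup>2)
      + pi * norm L * C * ((norm u)\<^sup>2 * exp (- pi\<^sup>2 * (norm u)\<^sup>2))" for u :: 'a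
  have W: "integrable lborel W"
    unfolding W_def
    by (intro Bochner_Integration.integrable_add integrable_mult_right integrable_gaussian integrable_norm2_gaussian) auto
  have h_meas [measurable]: "h s \<in> borel_measurable borel" for s
    unfolding h_def by measurable
  have h_le: "norm (h s u) \<le> W u" if "s > 0" for s u
  proof -
    have "norm ((G (s *\<^sub>R u) - G 0) /\<^sub>R s) \<le> C * norm u"
      using C(2)[of "s *\<^sub>R u"] that by (simp only: norm_scaleR) (simp add: field_simps)
    then have "\<bar>u \<bullet> L\<bar> * norm ((G (s *\<^sub>R u) - G 0) /\<^sub>R s) \<le> (norm u * norm L) * (C * norm u)"
      using C(1) by (intro mult_mono Cauchy_Schwarz_ineq2) auto
    then have "pi * (\<bar>u \<bullet> L\<bar> * norm ((G (s *\<^sub>R u) - G 0) /\<^sub>R s)) \<le> pi * ((norm u * norm L) * (C * norm u))"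
      by (intro mult_left_mono) auto
    moreover have "\<bar>a\<bar> * norm (G (s *\<^sub>R u)) \<le> \<bar>a\<bar> * M"
      by (intro mult_left_mono bdd) auto
    moreover have "norm (a * G (s *\<^sub>R u) + \<i> * pi * (u \<bullet> L) * ((G (s *\<^sub>R u) - G 0) /\<^sub>R s))
        \<le> \<bar>a\<bar> * norm (G (s *\<^sub>R u)) + pi * (\<bar>u \<bullet> L\<bar> * norm ((G (s *\<^sub>R u) - G 0) /\<^sub>R s))"
      by (rule order_trans[OF norm_triangle_ineq]) (simp only: norm_mult norm_ii norm_of_real, simp)
    ultimately have le: "norm (a * G (s *\<^sub>R u) + \<i> * pi * (u \<bullet> L) * ((G (s *\<^sub>R u) - G 0) /\<^sub>R s))
        \<le> \<bar>a\<bar> * M + pi * ((norm u * norm L) * (C * norm u))"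
      by linarith
    have eq: "pi * ((norm u * norm L) * (C * norm u)) = pi * norm L * C * (norm u)\<^sup>2"
      by (simp add: power2_eq_square)
    have "exp (- (s ^ 4 + pi\<^sup>2) * (norm u)\<^sup>2) \<le> exp (- pi\<^sup>2 * (norm u)\<^sup>2)"
      unfolding exp_le_cancel_iff by (rule mult_right_mono) auto
    then have "norm (h s u) \<le> exp (- pi\<^sup>2 * (norm u)\<^sup>2) * (\<bar>a\<bar> * M + pi * norm L * C * (norm u)\<^sup>2)"
      unfolding h_def norm_scaleR abs_exp_cancel using le[unfolded eq] by (intro mult_mono) auto
    then show ?thesis
      by (simp add: W_def algebra_simps)
  qed
  have h_int: "integrable lborel (h s)" if "s > 0" for s
    by (rule Bochner_Integration.integrable_bound[OF W]) (auto intro!: order_trans[OF h_le[OF that]])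
  have I_eq: "I \<epsilon> = sqrt pi ^ DIM('a) *\<^sub>R (\<integral>u. h (sqrt \<epsilon>) u \<partial>lborel)" if \<epsilon>: "\<epsilon> > 0" for \<epsilon>
  proof -
    define s where "s = sqrt \<epsilon>"
    have s: "s > 0" "\<epsilon> = s\<^sup>2"
      using \<epsilon> by (auto simp: s_def)
    \<comment> \<open>With position \<open>s *\<^sub>R u\<close>, the regularizing Gaussian
      contributes \<open>s ^ 4\<close> to the exponent and the transformed one contributes
      \<open>pi\<^sup>2\<close>.\<close>
    define c where "c = s ^ 4 + pi\<^sup>2"
    have c: "c > 0"
      unfolding c_def using s(1) by (intro add_pos_pos) auto
    define f where "f x y = complex_of_real (exp (- \<epsilon> * ((norm x)\<^sup>2 + (norm y)\<^sup>2))) *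
        (complex_of_real (a + x \<bullet> L) * e (x \<bullet> y) * G y)" for x y :: 'a
    have f_alt: "case_prod f = (\<lambda>\<xi>. complex_of_real (exp (- \<epsilon> * (norm \<xi>)\<^sup>2)) *
        (complex_of_real (a + fst \<xi> \<bullet> L) * e (fst \<xi> \<bullet> snd \<xi>) * G (snd \<xi>)))"
      by (auto simp: f_def norm_Pair)
    have "integrable lborel (case_prod f)"
      unfolding f_alt
    proof (rule Bochner_Integration.integrable_bound)
      show "integrable lborel (\<lambda>\<xi> :: 'a \<times> 'a. \<bar>a\<bar> * M * exp (- \<epsilon> * (norm \<xi>)\<^sup>2)
          + norm L * M * (norm \<xi> * exp (- \<epsilon> * (norm \<xi>)\<^sup>2)))"
        by (intro Bochner_Integration.integrable_add integrable_mult_right integrable_gaussian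
            integrable_norm_gaussian \<epsilon>)
      have "exp (- \<epsilon> * (norm \<xi>)\<^sup>2) * (\<bar>a + fst \<xi> \<bullet> L\<bar> * norm (G (snd \<xi>)))
          \<le> exp (- \<epsilon> * (norm \<xi>)\<^sup>2) * ((\<bar>a\<bar> + norm \<xi> * norm L) * M)" for \<xi> :: "'a \<times> 'a"
      proof (intro mult_left_mono mult_mono bdd)
        have "\<bar>fst \<xi> \<bullet> L\<bar> \<le> norm (fst \<xi>) * norm L"
          by (rule Cauchy_Schwarz_ineq2)
        also have "\<dots> \<le> norm \<xi> * norm L"
          using norm_fst_le[of "fst \<xi>" "snd \<xi>"] by (intro mult_right_mono) auto
        finally show "\<bar>a + fst \<xi> \<bullet> L\<bar> \<le> \<bar>a\<bar> + norm \<xi> * norm L"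
          by linarith
      qed auto
      then show "AE \<xi>::'a \<times> 'a in lborel. norm (complex_of_real (exp (- \<epsilon> * (norm \<xi>)\<^sup>2)) *
            (complex_of_real (a + fst \<xi> \<bullet> L) * e (fst \<xi> \<bullet> snd \<xi>) * G (snd \<xi>)))
          \<le> norm (\<bar>a\<bar> * M * exp (- \<epsilon> * (norm \<xi>)\<^sup>2) + norm L * M * (norm \<xi> * exp (- \<epsilon> * (norm \<xi>)\<^sup>2)))"
        using M by (intro AE_I2) (simp add: norm_mult algebra_simps flip: of_real_add)
      have "(\<lambda>\<xi>. complex_of_real (exp (- \<epsilon> * (norm \<xi>)\<^sup>2)) *
          (complex_of_real (a + fst \<xi> \<bullet> L) * e (fst \<xi> \<bullet> snd \<xi>) * G (snd \<xi>))) \<in> borel_measurable (borel \<Otimes>\<^sub>M borel)"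
        unfolding norm_prod_def by measurable
      then show "(\<lambda>\<xi>. complex_of_real (exp (- \<epsilon> * (norm \<xi>)\<^sup>2)) *
          (complex_of_real (a + fst \<xi> \<bullet> L) * e (fst \<xi> \<bullet> snd \<xi>) * G (snd \<xi>))) \<in> borel_measurable lborel"
        by (simp add: borel_prod)
    qed
    \<comment> \<open>Fubini, with the frequency integral inside: at a fixed position it is known in
      closed form.\<close>
    then have "I \<epsilon> = (\<integral>y. (\<integral>x. f x y \<partial>lborel) \<partial>lborel)"
      unfolding I_def f_alt[symmetric] lborel_prod[symmetric] by (rule lborel_pair.integral_snd[symmetric])
    also have "\<dots> = (\<integral>y. complex_of_real (exp (- \<epsilon> * (norm y)\<^sup>2)) * G y * ((a + \<i> * pi * (y \<bullet> L) / \<epsilon>) *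
        complex_of_real (sqrt (pi / \<epsilon>) ^ DIM('a) * exp (- (pi\<^sup>2 / \<epsilon>) * (norm y)\<^sup>2))) \<partial>lborel)"
    proof (intro Bochner_Integration.integral_cong refl)
      fix y :: 'a
      have "exp (- \<epsilon> * ((norm x)\<^sup>2 + (norm y)\<^sup>2)) = exp (- \<epsilon> * (norm x)\<^sup>2) * exp (- \<epsilon> * (norm y)\<^sup>2)" for x :: 'a
        by (simp only: distrib_left exp_add)
      then have "f x y = complex_of_real (exp (- \<epsilon> * (norm y)\<^sup>2)) * G y *
          (complex_of_real (exp (- \<epsilon> * (norm x)\<^sup>2)) * (complex_of_real (a + x \<bullet> L) * e (x \<bullet> y)))" for x
        by (simp only: f_def of_real_mult mult_ac)
      then show "(\<integral>x. f x y \<partial>lborel) = complex_of_real (exp (- \<epsilon> * (norm y)\<^sup>2)) * G y * ((a + \<i> * pi * (y \<bullet> L) / \<epsilon>) *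
        complex_of_real (sqrt (pi / \<epsilon>) ^ DIM('a) * exp (- (pi\<^sup>2 / \<epsilon>) * (norm y)\<^sup>2)))"
        by (simp only: integral_mult_right_zero integral_affine_gaussian_e[OF \<epsilon>])
    qed
    also have "\<dots> = \<bar>s\<bar> ^ DIM('a) *\<^sub>R (\<integral>u. complex_of_real (exp (- \<epsilon> * (norm (s *\<^sub>R u))\<^sup>2)) * G (s *\<^sub>R u) * ((a + \<i> * pi * ((s *\<^sub>R u) \<bullet> L) / \<epsilon>) *
        complex_of_real (sqrt (pi / \<epsilon>) ^ DIM('a) * exp (- (pi\<^sup>2 / \<epsilon>) * (norm (s *\<^sub>R u))\<^sup>2))) \<partial>lborel)"
      by (rule lborel_integral_scaleR) (use s in auto)
    \<comment> \<open>The contribution of \<open>G 0\<close>, singular in \<open>s\<close>, is split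
      off. The factor \<open>e (u \<bullet> 0)\<close>, equal to 1, puts it in the shape of the
      affine Gaussian integral at zero frequency, where it vanishes.\<close>
    also have "\<dots> = \<bar>s\<bar> ^ DIM('a) *\<^sub>R (\<integral>u. sqrt (pi / \<epsilon>) ^ DIM('a) *\<^sub>R
        (h s u + (\<i> * pi * G 0 / s) * (u \<bullet> L) *\<^sub>R (complex_of_real (exp (- c * (norm u)\<^sup>2)) * e (u \<bullet> 0))) \<partial>lborel)"
    proof (intro arg_cong[where f = "\<lambda>x. \<bar>s\<bar> ^ DIM('a) *\<^sub>R x"] Bochner_Integration.integral_cong refl)
      fix u :: 'a
      have 1: "exp (- \<epsilon> * (norm (s *\<^sub>R u))\<^sup>2) * exp (- (pi\<^sup>2 / \<epsilon>) * (norm (s *\<^sub>R u))\<^sup>2) = exp (- c * (norm u)\<^sup>2)"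
        using s(1) by (simp add: s(2) c_def power_mult_distrib algebra_simps power4_eq_xxxx power2_eq_square flip: exp_add)
      have 2: "(s *\<^sub>R u) \<bullet> L / \<epsilon> = (u \<bullet> L) / s"
        using s(1) by (simp add: s(2) power2_eq_square)
      have 3: "a * G (s *\<^sub>R u) + \<i> * pi * (u \<bullet> L) * ((G (s *\<^sub>R u) - G 0) /\<^sub>R s) + (\<i> * pi * G 0 / s) * (u \<bullet> L)
          = G (s *\<^sub>R u) * (a + \<i> * pi * complex_of_real ((u \<bullet> L) / s))"
        using s(1) by (simp add: scaleR_conv_of_real field_simps)
      show "complex_of_real (exp (- \<epsilon> * (norm (s *\<^sub>R u))\<^sup>2)) * G (s *\<^sub>R u) * ((a + \<i> * pi * ((s *\<^sub>R u) \<bullet> L) / \<epsilon>) *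
        complex_of_real (sqrt (pi / \<epsilon>) ^ DIM('a) * exp (- (pi\<^sup>2 / \<epsilon>) * (norm (s *\<^sub>R u))\<^sup>2)))
       = sqrt (pi / \<epsilon>) ^ DIM('a) *\<^sub>R
        (h s u + (\<i> * pi * G 0 / s) * (u \<bullet> L) *\<^sub>R (complex_of_real (exp (- c * (norm u)\<^sup>2)) * e (u \<bullet> 0)))" (is "?l = ?r")
      proof -
        have "?l = sqrt (pi / \<epsilon>) ^ DIM('a) *\<^sub>R (complex_of_real (exp (- \<epsilon> * (norm (s *\<^sub>R u))\<^sup>2) * exp (- (pi\<^sup>2 / \<epsilon>) * (norm (s *\<^sub>R u))\<^sup>2)) *
            (G (s *\<^sub>R u) * (a + \<i> * pi * complex_of_real ((s *\<^sub>R u) \<bullet> L / \<epsilon>))))"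
          by (simp only: scaleR_conv_of_real of_real_mult of_real_power of_real_divide mult_ac times_divide_eq_right times_divide_eq_left)
        also have "\<dots> = ?r"
          unfolding 1 2 3[symmetric] h_def c_def[symmetric]
          by (simp add: scaleR_conv_of_real algebra_simps)
        finally show ?thesis .
      qed
    qed
    also have "\<dots> = (\<bar>s\<bar> * sqrt (pi / \<epsilon>)) ^ DIM('a) *\<^sub>R ((\<integral>u. h s u \<partial>lborel) +
        (\<i> * pi * G 0 / s) * (\<integral>u. (u \<bullet> L) *\<^sub>R (complex_of_real (exp (- c * (norm u)\<^sup>2)) * e (u \<bullet> 0)) \<partial>lborel))"
    proof -
      define g where "g u = (u \<bullet> L) *\<^sub>R (complex_of_real (exp (- c * (norm u)\<^sup>2)) * e (u \<bullet> 0))" for u :: 'a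
      have "integrable lborel g"
        using integrable_gaussian_e(2)[OF c, of L 0] unfolding g_def .
      then show ?thesis
        unfolding g_def[symmetric] using h_int[OF s(1)] by (simp add: power_mult_distrib)
    qed
    also have "(\<integral>u. (u \<bullet> L) *\<^sub>R (complex_of_real (exp (- c * (norm u)\<^sup>2)) * e (u \<bullet> 0)) \<partial>lborel) = 0"
      using integral_affine_gaussian_e[OF c, of 0 L 0] by (simp add: scaleR_conv_of_real mult_ac)
    also have "\<bar>s\<bar> * sqrt (pi / \<epsilon>) = sqrt pi"
      using s(1) by (simp add: s(2) real_sqrt_divide)
    finally show ?thesis
      by (simp add: s_def)
  qed
  \<comment> \<open>The pointwise limit of \<open>h s\<close> as \<open>s\<close> tends to 0, with
    the difference quotient replaced by the derivative.\<close>
  define h0 where "h0 u = exp (- pi\<^sup>2 * (norm u)\<^sup>2) *\<^sub>R (a * G 0 + \<i> * pi * (u \<bullet> L) * D u)" for u :: 'a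
  have D_linear: "linear D"
    using D by (rule has_derivative_linear)
  have [measurable]: "D \<in> borel_measurable borel"
    by (intro borel_measurable_continuous_onI linear_continuous_on has_derivative_bounded_linear[OF D])
  have lim: "(I \<circ> X) \<longlonglongrightarrow> sqrt pi ^ DIM('a) *\<^sub>R (\<integral>u. h0 u \<partial>lborel)"
    if X: "\<And>n. X n > 0" "X \<longlonglongrightarrow> 0" for X
  proof -
    have sX: "(\<lambda>n. sqrt (X n)) \<longlonglongrightarrow> 0"
      using tendsto_real_sqrt[OF X(2)] by simp
    have "(\<lambda>n. \<integral>u. h (sqrt (X n)) u \<partial>lborel) \<longlonglongrightarrow> (\<integral>u. h0 u \<partial>lborel)"
    proof (rule integral_dominated_convergence[OF _ _ W])
      show "h0 \<in> borel_measurable lborel"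
        unfolding h0_def by measurable
      show "AE u in lborel. (\<lambda>n. h (sqrt (X n)) u) \<longlonglongrightarrow> h0 u"
      proof (rule AE_I2)
        fix u :: 'a
        have "isCont G 0"
          using D by (rule has_derivative_continuous)
        moreover have "(\<lambda>n. sqrt (X n) *\<^sub>R u) \<longlonglongrightarrow> 0"
          using tendsto_scaleR[OF sX tendsto_const[of u]] by simp
        ultimately have "(\<lambda>n. G (sqrt (X n) *\<^sub>R u)) \<longlonglongrightarrow> G 0"
          by (rule isCont_tendsto_compose)
        moreover have "(\<lambda>n. (G (sqrt (X n) *\<^sub>R u) - G 0) /\<^sub>R sqrt (X n)) \<longlonglongrightarrow> D u"
          using X(1) by (intro has_derivative_scaled_quotient_tendsto[OF D sX]) (simp add: less_imp_neq[symmetric])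
        moreover have "(\<lambda>n. exp (- (sqrt (X n) ^ 4 + pi\<^sup>2) * (norm u)\<^sup>2)) \<longlonglongrightarrow> exp (- pi\<^sup>2 * (norm u)\<^sup>2)"
          by (rule tendsto_eq_rhs, (rule tendsto_intros sX)+) simp
        ultimately show "(\<lambda>n. h (sqrt (X n)) u) \<longlonglongrightarrow> h0 u"
          unfolding h_def h0_def by (intro tendsto_scaleR tendsto_add tendsto_mult tendsto_const)
      qed
      show "AE u in lborel. norm (h (sqrt (X n)) u) \<le> W u" for n
        using X(1) by (intro AE_I2 h_le) simp
    qed simp
    then have "(\<lambda>n. sqrt pi ^ DIM('a) *\<^sub>R (\<integral>u. h (sqrt (X n)) u \<partial>lborel)) \<longlonglongrightarrow> sqrt pi ^ DIM('a) *\<^sub>R (\<integral>u. h0 u \<partial>lborel)"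
      by (intro tendsto_intros)
    then show ?thesis
      using X(1) by (simp add: o_def I_eq)
  qed
  have "(\<integral>u. h0 u \<partial>lborel) = (\<integral>u. exp (- pi\<^sup>2 * (norm u)\<^sup>2) *\<^sub>R (a * G 0) +
      (\<i> * pi) * ((exp (- pi\<^sup>2 * (norm u)\<^sup>2) * (u \<bullet> L)) *\<^sub>R D u) \<partial>lborel)"
    unfolding h0_def by (simp add: scaleR_conv_of_real algebra_simps)
  also have "\<dots> = (\<integral>(u::'a). exp (- pi\<^sup>2 * (norm u)\<^sup>2) \<partial>lborel) *\<^sub>R (a * G 0) +
      (\<i> * pi) * (\<integral>u. (exp (- pi\<^sup>2 * (norm u)\<^sup>2) * (u \<bullet> L)) *\<^sub>R D u \<partial>lborel)"
  proof -
    obtain K where K: "\<And>v. norm (D v) \<le> norm v * K" "K > 0"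
      using bounded_linear.pos_bounded[OF has_derivative_bounded_linear[OF D]] by blast
    have "integrable lborel (\<lambda>u. (\<i> * pi) * ((exp (- pi\<^sup>2 * (norm u)\<^sup>2) * (u \<bullet> L)) *\<^sub>R D u))"
    proof (intro integrable_mult_right, rule Bochner_Integration.integrable_bound)
      show "integrable lborel (\<lambda>u::'a. norm L * K * ((norm u)\<^sup>2 * exp (- pi\<^sup>2 * (norm u)\<^sup>2)))"
        by (intro integrable_mult_right integrable_norm2_gaussian) simp
      have "\<bar>u \<bullet> L\<bar> * norm (D u) \<le> (norm u * norm L) * (norm u * K)" for u
        by (intro mult_mono Cauchy_Schwarz_ineq2 K) auto
      then have "exp (- pi\<^sup>2 * (norm u)\<^sup>2) * (\<bar>u \<bullet> L\<bar> * norm (D u))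
          \<le> exp (- pi\<^sup>2 * (norm u)\<^sup>2) * ((norm u * norm L) * (norm u * K))" for u
        by (intro mult_left_mono) auto
      then show "AE u in lborel. norm ((exp (- pi\<^sup>2 * (norm u)\<^sup>2) * (u \<bullet> L)) *\<^sub>R D u)
          \<le> norm (norm L * K * ((norm u)\<^sup>2 * exp (- pi\<^sup>2 * (norm u)\<^sup>2)))"
        using K(2) by (simp add: abs_mult power2_eq_square mult_ac)
    qed measurable
    moreover have "integrable lborel (\<lambda>u::'a. exp (- pi\<^sup>2 * (norm u)\<^sup>2))"
      by (rule integrable_gaussian) simp
    ultimately show ?thesis
      by (simp only: Bochner_Integration.integral_add integrable_scaleR_left integral_scaleR_left integral_mult_right_zero)
  qed
  also have "(\<integral>(u::'a). exp (- pi\<^sup>2 * (norm u)\<^sup>2) \<partial>lborel) = sqrt (pi / pi\<^sup>2) ^ DIM('a)"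
  proof -
    have "complex_of_real (\<integral>(u::'a). exp (- pi\<^sup>2 * (norm u)\<^sup>2) \<partial>lborel) = complex_of_real (sqrt (pi / pi\<^sup>2) ^ DIM('a))"
      using integral_gaussian_e_Basis[where 'a='a, of "pi\<^sup>2" 0] by simp
    then show ?thesis
      by (simp only: of_real_eq_iff)
  qed
  also have "(\<integral>u. (exp (- pi\<^sup>2 * (norm u)\<^sup>2) * (u \<bullet> L)) *\<^sub>R D u \<partial>lborel)
      = (sqrt (pi / pi\<^sup>2) ^ DIM('a) / (2 * pi\<^sup>2)) *\<^sub>R D L"
    by (rule integral_inner_linear_gaussian[OF D_linear]) simp
  also have "sqrt (pi / pi\<^sup>2) = 1 / sqrt pi"
    by (simp add: power2_eq_square real_sqrt_divide)
  \<comment> \<open>The factor \<open>\<i> * pi\<close> times \<open>1 / (2 * pi\<^sup>2)\<close>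
    gives \<open>\<i> / (2 * pi)\<close>; the remaining power of \<open>sqrt pi\<close> cancels
    against the prefactor in \<open>I_eq\<close>.\<close>
  finally have h0: "(\<integral>u. h0 u \<partial>lborel) = (1 / sqrt pi ^ DIM('a)) *\<^sub>R (a * G 0 + \<i> / (2 * pi) * D L)"
    by (simp add: scaleR_conv_of_real power_divide power2_eq_square field_simps)
  show ?thesis
    unfolding I_def[symmetric]
    using lim by (auto simp: tendsto_at_iff_sequentially h0)
qed

section \<open>The operator psi as a first-order differential operator\<close>

text \<open>A map permuting the basis vectors permutes the sides of boxes and preserves their
  volumes, which characterize Lebesgue measure. It justifies reordering the integration variables
  across different nestings of pairs.\<close>

lemma lborel_distr_linear_Basis:
  fixes T :: "'a::euclidean_space \<Rightarrow> 'b::euclidean_space"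
  assumes "linear T" and bij: "bij_betw T Basis Basis"
  shows "distr lborel borel T = (lborel :: 'b measure)"
proof (rule lborel_eqI[symmetric])
  interpret T: linear T by fact
  have Basis: "T ` Basis = Basis" and inj: "inj_on T Basis"
    using bij by (auto simp: bij_betw_def)
  have T_inner: "T x \<bullet> T b = x \<bullet> b" if "b \<in> Basis" for x b
  proof -
    have "T x = T (\<Sum>c\<in>Basis. (x \<bullet> c) *\<^sub>R c)"
      by (simp add: euclidean_representation)
    also have "\<dots> = (\<Sum>c\<in>Basis. (x \<bullet> c) *\<^sub>R T c)"
      by (simp add: T.sum T.scale)
    finally have "T x \<bullet> T b = (\<Sum>c\<in>Basis. (x \<bullet> c) * (T c \<bullet> T b))"
      by (simp add: inner_sum_left)
    also have "\<dots> = (\<Sum>c\<in>Basis. (if c = b then x \<bullet> c else 0))"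
    proof (rule sum.cong)
      fix c :: 'a assume "c \<in> Basis"
      then have "T c \<in> Basis" "T b \<in> Basis" "T c = T b \<longleftrightarrow> c = b"
        using that Basis inj by (auto simp: inj_on_def)
      then show "(x \<bullet> c) * (T c \<bullet> T b) = (if c = b then x \<bullet> c else 0)"
        by (simp add: inner_Basis)
    qed simp
    finally show ?thesis
      using that by simp
  qed
  have T_meas [measurable]: "T \<in> borel_measurable borel"
    using assms(1) by (intro borel_measurable_continuous_onI linear_continuous_on)
      (simp add: linear_conv_bounded_linear)
  show "sets (distr lborel borel T) = sets borel"
    by simp
  fix l u :: 'b
  assume le: "\<And>b. b \<in> Basis \<Longrightarrow> l \<bullet> b \<le> u \<bullet> b"
  \<comment> \<open>The corners of the preimage box: the coordinates of \<open>l\<close> and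
    \<open>u\<close> permuted back along \<open>T\<close>.\<close>
  define l' u' where "l' = (\<Sum>b\<in>Basis. (l \<bullet> T b) *\<^sub>R b)" and "u' = (\<Sum>b\<in>Basis. (u \<bullet> T b) *\<^sub>R b)"
  have "x \<in> T -` box l u \<longleftrightarrow> x \<in> box l' u'" for x
    unfolding vimage_eq mem_box Basis[symmetric] ball_simps by (simp add: T_inner l'_def u'_def)
  then have "emeasure (distr lborel borel T) (box l u) = emeasure lborel (box l' u')"
    by (subst emeasure_distr) (auto simp: set_eq_iff intro!: arg_cong[where f = "emeasure lborel"])
  also have "\<dots> = (\<Prod>b\<in>Basis. (u' - l') \<bullet> b)"
    using le Basis by (subst emeasure_lborel_box) (auto simp: l'_def u'_def)
  also have "(\<Prod>b\<in>Basis. (u' - l') \<bullet> b) = (\<Prod>b\<in>Basis. (u - l) \<bullet> T b)"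
    by (intro prod.cong) (auto simp: l'_def u'_def inner_diff_left)
  also have "\<dots> = (\<Prod>b\<in>Basis. (u - l) \<bullet> b)"
    by (rule prod.reindex_bij_betw[OF bij])
  finally show "emeasure (distr lborel borel T) (box l u) = ennreal (\<Prod>b\<in>Basis. (u - l) \<bullet> b)" .
qed

section \<open>The bracket as multiplication plus derivation\<close>

text \<open>The zeroth-order coefficient: the amplitude of the bracket with all frequencies set to
  zero.\<close>

definition psi_phase :: "'n::finite vars \<Rightarrow> real" where
  "psi_phase = (\<lambda>(p, q, r, w, p', q', r', w'). 2 * (1 - exp (w - w')) * (p \<bullet> q'))"

text \<open>The first-order coefficient: each frequency in the amplitude acts as a derivative in its
  dual position, and the chain rule carries these derivatives to the variables of
  \<open>F\<close>.\<close>

definition psi_field :: "'n::finite vars \<Rightarrow> 'n vars" where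
  "psi_field = (\<lambda>(p, q, r, w, p', q', r', w').
     (r' *\<^sub>R p, - r' *\<^sub>R q + (2 * r) *\<^sub>R q', 0, 0, r *\<^sub>R p' - (2 * r' * exp (w - w')) *\<^sub>R p, - r *\<^sub>R q', 0, 0))"

text \<open>The integrand has an amplitude affine in the frequencies and depends on the positions
  only through \<open>F\<close> along a smooth map \<open>\<gamma>\<close> with
  \<open>\<gamma> 0 = z\<close>. Regularized Fourier inversion therefore differentiates
  \<open>F\<close> along the image of \<open>L\<close> under the derivative of
  \<open>\<gamma>\<close>, which is \<open>psi_field z\<close>.\<close>

lemma psi_bracket_eq:
  fixes F :: "'n::finite vars \<Rightarrow> complex"
  assumes cont: "continuous_on UNIV F" and bdd: "\<And>z. norm (F z) \<le> M"
    and D: "(F has_derivative D) (at z)"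
  shows "psi_bracket F z = psi_phase z * F z + \<i> / (2 * pi) * D (psi_field z)"
proof -
  obtain p q r w p' q' r' w' where z: "z = (p, q, r, w, p', q', r', w')"
    by (metis prod_cases7 surj_pair)
  \<comment> \<open>Regroup the integration variables into frequencies \<open>(s1, s2, xt, yt)\<close> and their dual
    positions \<open>(w1, w2, pt, qt)\<close>, so that the phase is the inner product of the two groups.\<close>
  define T :: "(real \<times> real \<times> (real ^ 'n) \<times> (real ^ 'n)) \<times> (real \<times> real \<times> (real ^ 'n) \<times> (real ^ 'n))
      \<Rightarrow> real \<times> real \<times> real \<times> real \<times> (real ^ 'n) \<times> (real ^ 'n) \<times> (real ^ 'n) \<times> (real ^ 'n)"
    where "T = (\<lambda>((s1, s2, xt, yt), (w1, w2, pt, qt)). (s1, s2, w1, w2, pt, qt, xt, yt))"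
  have T_linear: "linear T"
    by (auto simp: linear_iff T_def)
  have T_Basis: "T ` Basis = Basis"
    by (simp add: T_def Basis_prod_def image_Un image_image zero_prod_def insert_commute Un_ac)
  have T_inj: "inj T"
    by (auto simp: inj_def T_def)
  have T_norm: "norm (T \<eta>) = norm \<eta>" for \<eta>
    by (auto simp: T_def norm_Pair split: prod.splits)
  have T_meas: "T \<in> borel_measurable borel"
    using T_linear by (intro borel_measurable_continuous_onI linear_continuous_on)
      (simp add: linear_conv_bounded_linear)
  have T_lborel: "distr lborel borel T = lborel"
    using T_linear T_Basis T_inj by (intro lborel_distr_linear_Basis) (auto simp: bij_betw_def intro: inj_on_subset)
  define \<gamma> :: "real \<times> real \<times> (real ^ 'n) \<times> (real ^ 'n) \<Rightarrow> 'n vars"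
    where "\<gamma> v = (exp (fst v) *\<^sub>R p, exp (- fst v) *\<^sub>R q + snd (snd (snd v)), r, w,
      exp (fst (snd v)) *\<^sub>R p' + fst (snd (snd v)), exp (- fst (snd v)) *\<^sub>R q', r', w')" for v
  \<comment> \<open>The amplitude is \<open>a\<close> plus the inner product of the frequencies
    \<open>(s1, s2, xt, yt)\<close> with \<open>L\<close>.\<close>
  define a where "a = 2 * (p \<bullet> q' - exp (w - w') * (p \<bullet> q'))"
  define L where "L = (r', r, - (2 * r' * exp (w - w')) *\<^sub>R p, (2 * r) *\<^sub>R q')"
  define f where "f = (\<lambda>(s1 :: real, s2 :: real, w1 :: real, w2 :: real,
         pt :: real ^ 'n, qt :: real ^ 'n, xt :: real ^ 'n, yt :: real ^ 'n).
       complex_of_real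
         ((r * s2 + r' * s1) +
          2 * (p \<bullet> q' + r * (q' \<bullet> yt) - exp (w - w') * (p \<bullet> q')
               - r' * exp (w - w') * (p \<bullet> xt))) *
       e (s1 * w1 + s2 * w2) * e (pt \<bullet> xt + qt \<bullet> yt) *
       F (exp w1 *\<^sub>R p, exp (- w1) *\<^sub>R q + qt, r, w,
          exp w2 *\<^sub>R p' + pt, exp (- w2) *\<^sub>R q', r', w'))"
  have \<gamma>0: "\<gamma> 0 = z"
    by (simp add: \<gamma>_def z)
  have [measurable]: "(\<lambda>v. F (\<gamma> v)) \<in> borel_measurable borel"
    unfolding \<gamma>_def
    by (intro borel_measurable_continuous_onI continuous_on_compose2[OF cont] continuous_intros) auto
  have f_meas: "f \<in> borel_measurable borel"
    unfolding f_def case_prod_unfold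
    by (intro borel_measurable_continuous_onI continuous_on_compose2[OF cont] continuous_intros) auto
  have \<gamma>': "(\<gamma> has_derivative (\<lambda>h. (fst h *\<^sub>R p, - fst h *\<^sub>R q + snd (snd (snd h)), 0, 0,
      fst (snd h) *\<^sub>R p' + fst (snd (snd h)), - fst (snd h) *\<^sub>R q', 0, 0))) (at 0)"
    unfolding \<gamma>_def by (auto intro!: derivative_eq_intros simp: zero_prod_def)
  have "(F has_derivative D) (at (\<gamma> 0))"
    using D by (simp add: \<gamma>0)
  from has_derivative_compose[OF \<gamma>' this]
  have "((\<lambda>v. F (\<gamma> v)) has_derivative (\<lambda>h. D (fst h *\<^sub>R p, - fst h *\<^sub>R q + snd (snd (snd h)), 0, 0,
      fst (snd h) *\<^sub>R p' + fst (snd (snd h)), - fst (snd h) *\<^sub>R q', 0, 0))) (at 0)" .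
  note lim = tendsto_gaussian_regularization[OF _ _ this, of M a L]
  have fT: "f (T \<eta>) = complex_of_real (a + fst \<eta> \<bullet> L) * e (fst \<eta> \<bullet> snd \<eta>) * F (\<gamma> (snd \<eta>))" for \<eta>
  proof -
    obtain s1 s2 xt yt w1 w2 pt qt where \<eta>: "\<eta> = ((s1, s2, xt, yt), (w1, w2, pt, qt))"
      by (metis prod.collapse)
    have "fst \<eta> \<bullet> snd \<eta> = (s1 * w1 + s2 * w2) + (pt \<bullet> xt + qt \<bullet> yt)"
      by (simp add: \<eta> inner_commute)
    moreover have "a + fst \<eta> \<bullet> L = (r * s2 + r' * s1) +
          2 * (p \<bullet> q' + r * (q' \<bullet> yt) - exp (w - w') * (p \<bullet> q') - r' * exp (w - w') * (p \<bullet> xt))"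
      by (simp add: \<eta> a_def L_def inner_commute algebra_simps)
    \<comment> \<open>Fixing the first summand in \<open>e_add\<close> splits the phase only into
      the two factors that occur in \<open>f\<close>.\<close>
    ultimately show ?thesis
      by (simp only: e_add[of "s1 * w1 + s2 * w2"]) (simp add: \<eta> f_def T_def \<gamma>_def)
  qed
  have "(\<integral>\<xi>. complex_of_real (exp (- \<epsilon> * (norm \<xi>)\<^sup>2)) * f \<xi> \<partial>lborel)
      = (\<integral>\<eta>. complex_of_real (exp (- \<epsilon> * (norm \<eta>)\<^sup>2)) * f (T \<eta>) \<partial>lborel)" for \<epsilon>
    unfolding T_lborel[symmetric]
    using T_meas f_meas by (subst integral_distr) (simp_all add: T_norm)
  then have "osc_integral f = a * F (\<gamma> 0) + \<i> / (2 * pi) * D (r' *\<^sub>R p, - r' *\<^sub>R q + (2 * r) *\<^sub>R q', 0, 0,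
      r *\<^sub>R p' + - (2 * r' * exp (w - w')) *\<^sub>R p, - r *\<^sub>R q', 0, 0)"
    unfolding osc_integral_def using lim bdd
    by (intro tendsto_Lim) (simp_all add: fT L_def)
  moreover have "psi_bracket F z = osc_integral f"
    by (simp add: psi_bracket_def z f_def)
  ultimately show ?thesis
    by (simp add: z psi_phase_def psi_field_def a_def \<gamma>0[unfolded z] algebra_simps)
qed

section \<open>The flow realizing conjugation by the R-matrix\<close>

text \<open>Each factor \<open>1 + (z \<bullet> b)\<^sup>2\<close> is at most
  \<open>(1 + norm z)\<^sup>2\<close>, so two powers per dimension suffice to compare with a product
  of integrable functions of one variable.\<close>

lemma nn_integral_polynomial_decay_finite:
  "(\<integral>\<^sup>+z. ennreal (C / (1 + norm z) ^ (2 * DIM('a))) \<partial>(lborel :: 'a::euclidean_space measure)) < \<infinity>"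
proof -
  define g where "g t = 1 / (1 + t\<^sup>2)" for t :: real
  have g: "integrable lborel g"
    using integrable_inverse_1_plus_square by (simp add: set_integrable_def g_def[abs_def] divide_inverse)
  have [measurable]: "g \<in> borel_measurable borel"
    using g by (simp add: borel_measurable_integrable)
  have g_pos: "g t > 0" for t
    by (simp add: g_def add_pos_nonneg)
  have le: "1 / (1 + norm z) ^ (2 * DIM('a)) \<le> (\<Prod>b\<in>Basis. g (z \<bullet> b))" for z :: 'a
  proof -
    have "1 / (1 + norm z)\<^sup>2 \<le> g (z \<bullet> b)" if "b \<in> Basis" for b
    proof -
      have "(z \<bullet> b)\<^sup>2 \<le> (norm z)\<^sup>2"
        using Basis_le_norm[OF that, of z] by (metis abs_ge_zero power2_abs power_mono)
      then have "1 + (z \<bullet> b)\<^sup>2 \<le> (1 + norm z)\<^sup>2"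
        by (simp add: power2_sum add_increasing2)
      moreover have "0 < 1 + norm z" "0 < 1 + (z \<bullet> b)\<^sup>2"
        by (simp_all add: add_pos_nonneg)
      ultimately show ?thesis
        unfolding g_def by (intro divide_left_mono mult_pos_pos) auto
    qed
    then have "(\<Prod>b\<in>(Basis::'a set). 1 / (1 + norm z)\<^sup>2) \<le> (\<Prod>b\<in>Basis. g (z \<bullet> b))"
      by (intro prod_mono) auto
    then show ?thesis
      by (simp add: power_one_over power_mult)
  qed
  have "(\<integral>\<^sup>+z. ennreal (C / (1 + norm z) ^ (2 * DIM('a))) \<partial>(lborel :: 'a measure))
      \<le> (\<integral>\<^sup>+z. ennreal \<bar>C\<bar> * (\<Prod>b\<in>Basis. ennreal (g (z \<bullet> b))) \<partial>(lborel :: 'a measure))"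
  proof (rule nn_integral_mono)
    fix z :: 'a
    have "C / (1 + norm z) ^ (2 * DIM('a)) \<le> \<bar>C\<bar> * (1 / (1 + norm z) ^ (2 * DIM('a)))"
      by (simp add: divide_right_mono)
    also have "\<dots> \<le> \<bar>C\<bar> * (\<Prod>b\<in>Basis. g (z \<bullet> b))"
      by (intro mult_left_mono le) auto
    finally show "ennreal (C / (1 + norm z) ^ (2 * DIM('a))) \<le> ennreal \<bar>C\<bar> * (\<Prod>b\<in>Basis. ennreal (g (z \<bullet> b)))"
      using g_pos by (simp add: prod_ennreal less_imp_le ennreal_leI flip: ennreal_mult')
  qed
  also have "\<dots> = ennreal \<bar>C\<bar> * (\<Prod>b\<in>(Basis :: 'a set). (\<integral>\<^sup>+t. ennreal (g t) \<partial>lborel))"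
    by (subst nn_integral_cmult) (simp_all add: nn_integral_lborel_prod[of "\<lambda>_ t. ennreal (g t)", simplified])
  also have "\<dots> < \<infinity>"
    using g g_pos by (simp add: nn_integral_eq_integral less_imp_le ennreal_mult_less_top ennreal_power power_less_top_ennreal)
  finally show ?thesis .
qed

lemma schwartz_differentiable: "schwartz F \<Longrightarrow> F differentiable (at x)"
  unfolding schwartz_def by (metis empty_set empty_subsetI iterated_deriv.simps(1))

text \<open>The lists \<open>[]\<close> and \<open>[b]\<close> supply bounds for the value and the
  partial derivatives; expanding \<open>v\<close> in the basis extends them to all directions.
  Adding the constants gives one that serves both bounds.\<close>

lemma schwartz_decay:
  fixes F :: "'a::euclidean_space \<Rightarrow> complex"
  assumes "schwartz F"
  obtains C where "C \<ge> 0" "\<And>x. (1 + norm x) ^ k * norm (F x) \<le> C"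
    "\<And>x v. (1 + norm x) ^ k * norm (frechet_derivative F (at x) v) \<le> C * norm v"
proof -
  have diff: "F differentiable (at x)" for x
    using assms by (rule schwartz_differentiable)
  have "\<exists>C. \<forall>x. (1 + norm x) ^ k * norm (iterated_deriv [] F x) \<le> C"
    using assms unfolding schwartz_def by (metis empty_set empty_subsetI)
  then obtain C0 where C0: "\<And>x. (1 + norm x) ^ k * norm (F x) \<le> C0"
    by auto
  have "\<exists>C. \<forall>x. (1 + norm x) ^ k * norm (iterated_deriv [b] F x) \<le> C" if "b \<in> Basis" for b
    using assms that unfolding schwartz_def by (metis empty_set insert_subset empty_subsetI list.set(2))
  then obtain C1 where C1: "\<And>b x. b \<in> Basis \<Longrightarrow> (1 + norm x) ^ k * norm (frechet_derivative F (at x) b) \<le> C1 b"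
    by simp metis
  have C0_nonneg: "C0 \<ge> 0"
    using order_trans[OF norm_ge_zero[of "F 0"]] C0[of 0] by simp
  have "0 \<le> (1 + norm (0::'a)) ^ k * norm (frechet_derivative F (at 0) b)" for b
    by simp
  then have C1_nonneg: "C1 b \<ge> 0" if "b \<in> Basis" for b
    using C1[OF that] order_trans by blast
  show ?thesis
  proof (rule that[of "C0 + (\<Sum>b\<in>Basis. C1 b)"])
    show "0 \<le> C0 + (\<Sum>b\<in>Basis. C1 b)"
      using C0_nonneg C1_nonneg by (intro add_nonneg_nonneg sum_nonneg) auto
    show "(1 + norm x) ^ k * norm (F x) \<le> C0 + (\<Sum>b\<in>Basis. C1 b)" for x
      using C0[of x] sum_nonneg[of Basis C1] C1_nonneg by force
    show "(1 + norm x) ^ k * norm (frechet_derivative F (at x) v) \<le> (C0 + (\<Sum>b\<in>Basis. C1 b)) * norm v" for x v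
    proof -
      have lin: "linear (frechet_derivative F (at x))"
        using diff by (rule linear_frechet_derivative)
      have "norm (frechet_derivative F (at x) v) = norm (\<Sum>b\<in>Basis. (v \<bullet> b) *\<^sub>R frechet_derivative F (at x) b)"
        by (subst euclidean_representation[symmetric, of v]) (simp add: linear_sum[OF lin] linear_scale[OF lin])
      also have "\<dots> \<le> (\<Sum>b\<in>Basis. norm v * norm (frechet_derivative F (at x) b))"
        by (rule order_trans[OF norm_sum sum_mono]) (auto intro!: mult_right_mono Basis_le_norm)
      finally have "(1 + norm x) ^ k * norm (frechet_derivative F (at x) v)
          \<le> (1 + norm x) ^ k * (\<Sum>b\<in>Basis. norm v * norm (frechet_derivative F (at x) b))"
        by (intro mult_left_mono) auto
      also have "\<dots> = norm v * (\<Sum>b\<in>Basis. (1 + norm x) ^ k * norm (frechet_derivative F (at x) b))"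
        by (simp add: sum_distrib_left mult_ac)
      also have "\<dots> \<le> norm v * (\<Sum>b\<in>Basis. C1 b)"
        by (intro mult_left_mono sum_mono C1) auto
      also have "\<dots> \<le> (C0 + (\<Sum>b\<in>Basis. C1 b)) * norm v"
        using C0_nonneg by (simp add: algebra_simps)
      finally show ?thesis .
    qed
  qed
qed

text \<open>Multiplying out \<open>2 * l * eta l\<close> makes the transformation smooth through \<open>l = 0\<close>,
  where \<open>eta\<close> itself takes the junk value \<open>0\<close>; \<open>psi_velocity\<close> and \<open>psi_angle'\<close>
  are the derivatives in \<open>l\<close>.\<close>

definition psi_flow :: "real \<Rightarrow> 'n::finite vars \<Rightarrow> 'n vars" where
  "psi_flow l = (\<lambda>(p, q, r, w, p', q', r', w').
     (exp (l * r') *\<^sub>R p,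
      exp (- l * r') *\<^sub>R q + (exp (l * (r - r')) - exp (- l * (r + r'))) *\<^sub>R q',
      r, w,
      exp (l * r) *\<^sub>R p' - (exp (w - w' + 2 * l * r') - exp (w - w')) *\<^sub>R p,
      exp (- l * r) *\<^sub>R q', r', w'))"

definition psi_velocity :: "real \<Rightarrow> 'n::finite vars \<Rightarrow> 'n vars" where
  "psi_velocity l = (\<lambda>(p, q, r, w, p', q', r', w').
     ((r' * exp (l * r')) *\<^sub>R p,
      (- r' * exp (- l * r')) *\<^sub>R q + ((r - r') * exp (l * (r - r')) + (r + r') * exp (- l * (r + r'))) *\<^sub>R q',
      0, 0,
      (r * exp (l * r)) *\<^sub>R p' - (2 * r' * exp (w - w' + 2 * l * r')) *\<^sub>R p,
      (- r * exp (- l * r)) *\<^sub>R q', 0, 0))"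

definition psi_angle :: "real \<Rightarrow> 'n::finite vars \<Rightarrow> real" where
  "psi_angle l = (\<lambda>(p, q, r, w, p', q', r', w'). 2 * l * (exp (w - w' - l * r) - exp (- l * r)) * (p \<bullet> q'))"

definition psi_angle' :: "real \<Rightarrow> 'n::finite vars \<Rightarrow> real" where
  "psi_angle' l = (\<lambda>(p, q, r, w, p', q', r', w').
     2 * (1 - l * r) * (exp (w - w' - l * r) - exp (- l * r)) * (p \<bullet> q'))"

text \<open>The two phases combine into one character, and clearing the denominator of
  \<open>eta\<close> (possible as \<open>l \<noteq> 0\<close>) turns its coefficients into
  differences of exponentials.\<close>

lemma Psi_eq_flow:
  assumes "l \<noteq> 0"
  shows "Psi l F z = e (psi_angle l z) * F (psi_flow l z)"
proof -
  obtain p q r w p' q' r' w' where z: "z = (p, q, r, w, p', q', r', w')"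
    by (metis prod_cases7 surj_pair)
  have eta: "2 * l * c * eta l t = c * exp (2 * l * t) - c" for c t
    using assms by (simp add: eta_def field_simps)
  have e_diff: "ebar s * e t = e (t - s)" for s t
    by (simp add: e_def ebar_def algebra_simps flip: exp_add)
  have "ebar (2 * l * exp (- l * r) * (p \<bullet> q')) * e (2 * l * exp (w - w' - l * r) * (p \<bullet> q')) = e (psi_angle l z)"
    unfolding e_diff by (simp add: z psi_angle_def algebra_simps)
  then show ?thesis
    unfolding Psi_def eta
    by (simp add: z eta psi_flow_def algebra_simps flip: exp_add)
qed

lemma psi_flow_0 [simp]: "psi_flow 0 z = z"
  by (auto simp: psi_flow_def split: prod.splits)

lemma psi_angle_0 [simp]: "psi_angle 0 z = 0"
  by (auto simp: psi_angle_def split: prod.splits)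

lemma psi_velocity_0: "psi_velocity 0 z = psi_field z"
  by (auto simp: psi_velocity_def psi_field_def split: prod.splits)

lemma psi_angle'_0: "psi_angle' 0 z = - psi_phase z"
  by (auto simp: psi_angle'_def psi_phase_def algebra_simps split: prod.splits)

section \<open>Derivatives in the deformation parameter\<close>

lemma has_derivative_psi_flow:
  "((\<lambda>l. psi_flow l z) has_derivative (\<lambda>h. h *\<^sub>R psi_velocity l z)) (at l)"
proof -
  obtain p q r w p' q' r' w' where z: "z = (p, q, r, w, p', q', r', w')"
    by (metis prod_cases7 surj_pair)
  show ?thesis
    unfolding z psi_flow_def psi_velocity_def prod.case
    by (auto intro!: derivative_eq_intros simp: zero_prod_def algebra_simps)
qed

lemma has_derivative_psi_angle:
  "((\<lambda>l. psi_angle l z) has_derivative (\<lambda>h. h * psi_angle' l z)) (at l)"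
proof -
  obtain p q r w p' q' r' w' where z: "z = (p, q, r, w, p', q', r', w')"
    by (metis prod_cases7 surj_pair)
  show ?thesis
    unfolding z psi_angle_def psi_angle'_def prod.case
    by (auto intro!: derivative_eq_intros simp: algebra_simps)
qed

text \<open>Product and chain rule. The derivative is taken at every \<open>l\<close>: its value at
  0 identifies the limit, and its values on a whole interval enter the mean value estimate.\<close>

lemma has_derivative_flow_pullback:
  assumes "\<And>x. F differentiable (at x)"
  shows "((\<lambda>l. e (psi_angle l z) * F (psi_flow l z)) has_derivative
    (\<lambda>h. h *\<^sub>R (e (psi_angle l z) * (2 * pi * \<i> * psi_angle' l z * F (psi_flow l z)
      + frechet_derivative F (at (psi_flow l z)) (psi_velocity l z))))) (at l)"
proof -
  define D where "D = frechet_derivative F (at (psi_flow l z))"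
  have D: "(F has_derivative D) (at (psi_flow l z))"
    using assms unfolding D_def by (simp add: frechet_derivative_works)
  have "((\<lambda>t. e (t * 1)) has_derivative (\<lambda>h. h *\<^sub>R (2 * pi * \<i> * e t))) (at t)" for t
    using has_vector_derivative_e[of 1 t] by (simp add: has_vector_derivative_def)
  then have e: "(e has_derivative (\<lambda>h. h *\<^sub>R (2 * pi * \<i> * e t))) (at t)" for t
    by simp
  show ?thesis
    unfolding D_def[symmetric]
    by (rule has_derivative_eq_rhs, rule has_derivative_mult
          [OF has_derivative_compose[OF has_derivative_psi_angle e]
              has_derivative_compose[OF has_derivative_psi_flow D]])
       (auto simp: linear_scale[OF has_derivative_linear[OF D]] scaleR_conv_of_real algebra_simps)
qed

section \<open>Uniform norm bounds for the flow\<close>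

lemma norm_tuple8_le:
  "norm (a, b, c, d, a', b', c', d') \<le> norm a + norm b + norm c + norm d + norm a' + norm b' + norm c' + norm d'"
  unfolding add.assoc by (intro order_trans[OF norm_Pair_le] add_left_mono order_refl)

lemma norm_tuple8_component_le:
  "norm a \<le> norm (a, b, c, d, a', b', c', d')" "norm b \<le> norm (a, b, c, d, a', b', c', d')"
  "norm c \<le> norm (a, b, c, d, a', b', c', d')" "norm d \<le> norm (a, b, c, d, a', b', c', d')"
  "norm a' \<le> norm (a, b, c, d, a', b', c', d')" "norm b' \<le> norm (a, b, c, d, a', b', c', d')"
  "norm c' \<le> norm (a, b, c, d, a', b', c', d')" "norm d' \<le> norm (a, b, c, d, a', b', c', d')"
  by (rule norm_fst_le order_refl order_trans[OF _ norm_snd_le])+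

text \<open>For bounded \<open>r, w, r', w'\<close> and \<open>l\<close>, the flow acts linearly on
  the vector variables with bounded coefficients, and so does its inverse. The last bound converts
  decay at \<open>psi_flow l z\<close> into decay at \<open>z\<close>.\<close>

lemma psi_flow_bounds:
  assumes "R \<ge> 1"
  obtains B where "B \<ge> 1"
    "\<And>l p q r w p' q' r' w' (z :: 'n::finite vars). z = (p, q, r, w, p', q', r', w') \<Longrightarrow> \<bar>l\<bar> \<le> 1 \<Longrightarrow>
      \<bar>r\<bar> \<le> R \<Longrightarrow> \<bar>w\<bar> \<le> R \<Longrightarrow> \<bar>r'\<bar> \<le> R \<Longrightarrow> \<bar>w'\<bar> \<le> R \<Longrightarrow>
      norm (psi_velocity l z) \<le> B * norm z \<and> \<bar>psi_angle' l z\<bar> \<le> B * (norm z)\<^sup>2 \<and> norm z \<le> B * norm (psi_flow l z)"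
proof -
  \<comment> \<open>A bound for every exponential involved; the largest exponent,
    \<open>w - w' + 2 * l * r'\<close>, is at most \<open>4 * R\<close>.\<close>
  define K where "K = exp (4 * R)"
  have K: "K \<ge> 1"
    using assms by (simp add: K_def)
  \<comment> \<open>The three estimates produce the factors \<open>10 * (R * K)\<close>,
    \<open>4 * R * K\<close> and \<open>4 + 4 * K + 2 * K ^ 3\<close>, all at most
    \<open>B\<close>.\<close>
  define B where "B = 12 * R * K ^ 3"
  have RK: "1 \<le> R * K ^ 3" "R * K \<le> R * K ^ 3" "K \<le> R * K ^ 3" "K ^ 3 \<le> R * K ^ 3"
  proof -
    have "K \<le> K ^ 3" and K3: "1 \<le> K ^ 3"
      using K power_increasing[of 1 3 K] by simp_all
    moreover have "K ^ 3 \<le> R * K ^ 3"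
      using mult_right_mono[OF assms, of "K ^ 3"] K by simp
    ultimately show "1 \<le> R * K ^ 3" "R * K \<le> R * K ^ 3" "K \<le> R * K ^ 3" "K ^ 3 \<le> R * K ^ 3"
      using assms by (auto intro: mult_left_mono)
  qed
  show ?thesis
  proof (rule that[of B])
    show "B \<ge> 1"
      using RK by (simp add: B_def)
  next
    fix l :: real and p q r w p' q' r' w' and z :: "'n vars"
    assume z: "z = (p, q, r, w, p', q', r', w')"
      and l: "\<bar>l\<bar> \<le> 1" and bounds: "\<bar>r\<bar> \<le> R" "\<bar>w\<bar> \<le> R" "\<bar>r'\<bar> \<le> R" "\<bar>w'\<bar> \<le> R"
    define N where "N = norm z"
    have N: "norm p \<le> N" "norm q \<le> N" "norm p' \<le> N" "norm q' \<le> N" "N \<ge> 0"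
      unfolding N_def z by (rule norm_tuple8_component_le)+ simp
    have lr: "\<bar>l * r\<bar> \<le> R" "\<bar>l * r'\<bar> \<le> R"
      using mult_mono[OF l bounds(1)] mult_mono[OF l bounds(3)] by (simp_all add: abs_mult)
    have exps: "exp (l * r') \<le> K" "exp (- l * r') \<le> K" "exp (l * r) \<le> K" "exp (- l * r) \<le> K"
        "exp (l * (r - r')) \<le> K" "exp (- l * (r + r')) \<le> K" "exp (w - w' + 2 * l * r') \<le> K"
        "exp (w - w') \<le> K" "exp (w - w' - l * r) \<le> K"
      using lr bounds assms unfolding K_def by (auto simp: algebra_simps)
    have smult: "norm (c *\<^sub>R x) \<le> C * Y" if "\<bar>c\<bar> \<le> C" "norm x \<le> Y" for c C Y and x :: "real ^ 'n"
      using mult_mono[OF that] that by (simp add: order_trans[OF abs_ge_zero])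
    have prod: "\<bar>s * x\<bar> \<le> S * K" if "\<bar>s\<bar> \<le> S" "0 \<le> x" "x \<le> K" for s S x
      using mult_mono[OF that(1), of x K] that by (simp add: abs_mult order_trans[OF abs_ge_zero])
    have dif: "\<bar>x - y\<bar> \<le> K" if "0 < x" "0 < y" "x \<le> K" "y \<le> K" for x y
      using that by linarith
    have v: "norm ((r' * exp (l * r')) *\<^sub>R p) \<le> (R * K) * N"
      "norm ((- r' * exp (- l * r')) *\<^sub>R q) \<le> (R * K) * N"
      "norm (((r - r') * exp (l * (r - r')) + (r + r') * exp (- l * (r + r'))) *\<^sub>R q') \<le> (2 * R * K + 2 * R * K) * N"
      "norm ((r * exp (l * r)) *\<^sub>R p') \<le> (R * K) * N"
      "norm ((2 * r' * exp (w - w' + 2 * l * r')) *\<^sub>R p) \<le> (2 * R * K) * N"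
      "norm ((- r * exp (- l * r)) *\<^sub>R q') \<le> (R * K) * N"
      using bounds by (intro smult N prod exps order_trans[OF abs_triangle_ineq] add_mono; simp)+
    have "norm (psi_velocity l z) \<le> norm ((r' * exp (l * r')) *\<^sub>R p) + norm ((- r' * exp (- l * r')) *\<^sub>R q
        + ((r - r') * exp (l * (r - r')) + (r + r') * exp (- l * (r + r'))) *\<^sub>R q')
        + norm (0 :: real) + norm (0 :: real)
        + norm ((r * exp (l * r)) *\<^sub>R p' - (2 * r' * exp (w - w' + 2 * l * r')) *\<^sub>R p)
        + norm ((- r * exp (- l * r)) *\<^sub>R q') + norm (0 :: real) + norm (0 :: real)"
      unfolding z psi_velocity_def prod.case by (rule norm_tuple8_le)
    also have "\<dots> \<le> 10 * (R * K) * N"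
      using v norm_triangle_ineq[of "(- r' * exp (- l * r')) *\<^sub>R q" "((r - r') * exp (l * (r - r')) + (r + r') * exp (- l * (r + r'))) *\<^sub>R q'"]
        norm_triangle_ineq4[of "(r * exp (l * r)) *\<^sub>R p'" "(2 * r' * exp (w - w' + 2 * l * r')) *\<^sub>R p"]
      by (simp add: algebra_simps)
    also have "\<dots> \<le> B * N"
      using RK(2) K assms N(5) unfolding B_def by (intro mult_right_mono) (auto simp: algebra_simps)
    finally have 1: "norm (psi_velocity l z) \<le> B * norm z"
      by (simp add: N_def)
    have "\<bar>psi_angle' l z\<bar> = \<bar>2 * (1 - l * r)\<bar> * \<bar>exp (w - w' - l * r) - exp (- l * r)\<bar> * \<bar>p \<bullet> q'\<bar>"
      by (simp add: z psi_angle'_def abs_mult)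
    also have "\<dots> \<le> (4 * R) * K * (N * N)"
    proof (intro mult_mono)
      have "\<bar>1 - l * r\<bar> \<le> 2 * R"
        using lr assms by linarith
      then show "\<bar>2 * (1 - l * r)\<bar> \<le> 4 * R"
        by (simp add: abs_mult)
      show "\<bar>p \<bullet> q'\<bar> \<le> N * N"
        using Cauchy_Schwarz_ineq2[of p q'] mult_mono[OF N(1) N(4)] N(5) by simp
    qed (use dif exps K assms N in auto)
    also have "\<dots> \<le> B * (N * N)"
      using RK(2) K assms N(5) unfolding B_def by (intro mult_right_mono) (auto simp: algebra_simps)
    finally have 2: "\<bar>psi_angle' l z\<bar> \<le> B * (norm z)\<^sup>2"
      by (simp add: N_def power2_eq_square)
    define Y where "Y = norm (psi_flow l z)"
    define P Q P' Q' where "P = exp (l * r') *\<^sub>R p"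
      and "Q = exp (- l * r') *\<^sub>R q + (exp (l * (r - r')) - exp (- l * (r + r'))) *\<^sub>R q'"
      and "P' = exp (l * r) *\<^sub>R p' - (exp (w - w' + 2 * l * r') - exp (w - w')) *\<^sub>R p"
      and "Q' = exp (- l * r) *\<^sub>R q'"
    have flow: "psi_flow l z = (P, Q, r, w, P', Q', r', w')"
      by (simp add: z psi_flow_def P_def Q_def P'_def Q'_def)
    have Y: "norm P \<le> Y" "norm Q \<le> Y" "norm r \<le> Y" "norm w \<le> Y" "norm P' \<le> Y" "norm Q' \<le> Y"
        "norm r' \<le> Y" "norm w' \<le> Y"
      unfolding Y_def flow by (rule norm_tuple8_component_le)+
    \<comment> \<open>The flow is triangular: \<open>p\<close> and \<open>q'\<close> are recovered
      by rescaling, and then \<open>q\<close> and \<open>p'\<close> after removing multiples of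
      \<open>q'\<close> and \<open>p\<close>.\<close>
    have "p = exp (- l * r') *\<^sub>R P"
      by (simp add: P_def flip: exp_add)
    then have p: "norm p \<le> K * Y"
      using smult[of "exp (- l * r')" K P Y] exps Y by simp
    have "q' = exp (l * r) *\<^sub>R Q'"
      by (simp add: Q'_def flip: exp_add)
    then have q': "norm q' \<le> K * Y"
      using smult[of "exp (l * r)" K Q' Y] exps Y by simp
    have "q = exp (l * r') *\<^sub>R (Q - (exp (l * (r - r')) - exp (- l * (r + r'))) *\<^sub>R q')"
      by (simp add: Q_def flip: exp_add)
    moreover have "norm (Q - (exp (l * (r - r')) - exp (- l * (r + r'))) *\<^sub>R q') \<le> Y + K * (K * Y)"
      by (intro order_trans[OF norm_triangle_ineq4] add_mono Y smult q' dif exps) auto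
    ultimately have q: "norm q \<le> K * (Y + K * (K * Y))"
      using smult[of "exp (l * r')" K "Q - (exp (l * (r - r')) - exp (- l * (r + r'))) *\<^sub>R q'" "Y + K * (K * Y)"] exps
      by simp
    have "p' = exp (- l * r) *\<^sub>R (P' + (exp (w - w' + 2 * l * r') - exp (w - w')) *\<^sub>R p)"
      by (simp add: P'_def flip: exp_add)
    moreover have "norm (P' + (exp (w - w' + 2 * l * r') - exp (w - w')) *\<^sub>R p) \<le> Y + K * (K * Y)"
      by (intro order_trans[OF norm_triangle_ineq] add_mono Y smult p dif exps) auto
    ultimately have p': "norm p' \<le> K * (Y + K * (K * Y))"
      using smult[of "exp (- l * r)" K "P' + (exp (w - w' + 2 * l * r') - exp (w - w')) *\<^sub>R p" "Y + K * (K * Y)"] exps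
      by simp
    have "norm z \<le> norm p + norm q + norm r + norm w + norm p' + norm q' + norm r' + norm w'"
      unfolding z by (rule norm_tuple8_le)
    also have "\<dots> \<le> (4 + 4 * K + 2 * K ^ 3) * Y"
      using p q p' q' Y by (simp add: algebra_simps power3_eq_cube)
    also have "\<dots> \<le> B * Y"
      unfolding B_def using RK by (intro mult_right_mono) (auto simp: Y_def)
    finally have 3: "norm z \<le> B * norm (psi_flow l z)"
      by (simp add: Y_def)
    show "norm (psi_velocity l z) \<le> B * norm z \<and> \<bar>psi_angle' l z\<bar> \<le> B * (norm z)\<^sup>2 \<and> norm z \<le> B * norm (psi_flow l z)"
      using 1 2 3 by blast
  qed
qed

section \<open>Domination and convergence\<close>

text \<open>The mean value theorem in \<open>l\<close> on the interval from -1 to 1, with Schwartz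
  decay of \<open>F\<close> and its derivative absorbing the polynomial growth of
  \<open>psi_angle'\<close> and \<open>psi_velocity\<close>.\<close>

lemma pullback_derivative_decay:
  fixes F :: "'n::finite vars \<Rightarrow> complex"
  assumes "schwartz F" "compact_support_rw F"
  obtains C where "\<And>l z. \<bar>l\<bar> \<le> 1 \<Longrightarrow>
    norm (e (psi_angle l z) * F (psi_flow l z) - F z) \<le> C / (1 + norm z) ^ (2 * DIM('n vars)) * \<bar>l\<bar>"
proof -
  have diff: "F differentiable (at x)" for x
    using assms(1) by (rule schwartz_differentiable)
  obtain S where S: "compact S"
    "\<And>p q r w p' q' r' w'. (r, w, r', w') \<notin> S \<Longrightarrow> F (p, q, r, w, p', q', r', w') = 0"
    using assms(2) unfolding compact_support_rw_def by blast
  obtain R0 where R0: "\<And>x. x \<in> S \<Longrightarrow> norm x \<le> R0"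
    using compact_imp_bounded[OF S(1)] by (auto simp: bounded_iff)
  define R where "R = max 1 R0"
  have R: "\<bar>r\<bar> \<le> R" "\<bar>w\<bar> \<le> R" "\<bar>r'\<bar> \<le> R" "\<bar>w'\<bar> \<le> R" if "(r, w, r', w') \<in> S" for r w r' w'
  proof -
    have "norm r \<le> norm (r, w, r', w')" "norm w \<le> norm (r, w, r', w')"
      "norm r' \<le> norm (r, w, r', w')" "norm w' \<le> norm (r, w, r', w')"
      by (rule norm_fst_le order_refl order_trans[OF _ norm_snd_le])+
    then show "\<bar>r\<bar> \<le> R" "\<bar>w\<bar> \<le> R" "\<bar>r'\<bar> \<le> R" "\<bar>w'\<bar> \<le> R"
      using R0[OF that] by (simp_all add: R_def)
  qed
  obtain B where B: "B \<ge> 1"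
    "\<And>l p q r w p' q' r' w' (z :: 'n vars). z = (p, q, r, w, p', q', r', w') \<Longrightarrow> \<bar>l\<bar> \<le> 1 \<Longrightarrow>
      \<bar>r\<bar> \<le> R \<Longrightarrow> \<bar>w\<bar> \<le> R \<Longrightarrow> \<bar>r'\<bar> \<le> R \<Longrightarrow> \<bar>w'\<bar> \<le> R \<Longrightarrow>
      norm (psi_velocity l z) \<le> B * norm z \<and> \<bar>psi_angle' l z\<bar> \<le> B * (norm z)\<^sup>2 \<and> norm z \<le> B * norm (psi_flow l z)"
    using psi_flow_bounds[of R] by (auto simp: R_def)
  define d where "d = 2 * DIM('n vars)"
  \<comment> \<open>\<open>d\<close> powers remain for integrability, and two absorb the quadratic
    growth of \<open>psi_angle'\<close>.\<close>
  define k where "k = d + 2"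
  obtain C where C: "C \<ge> 0" "\<And>x. (1 + norm x) ^ k * norm (F x) \<le> C"
    "\<And>x v. (1 + norm x) ^ k * norm (frechet_derivative F (at x) v) \<le> C * norm v"
    using schwartz_decay[OF assms(1)] by metis
  define g where "g z l = e (psi_angle l z) * F (psi_flow l z)" for z l
  define g' where "g' z l = e (psi_angle l z) * (2 * pi * \<i> * psi_angle' l z * F (psi_flow l z)
      + frechet_derivative F (at (psi_flow l z)) (psi_velocity l z))" for z l
  have deriv: "(g z has_derivative (\<lambda>h. h *\<^sub>R g' z l)) (at l)" for z l
    unfolding g_def[abs_def] g'_def by (rule has_derivative_flow_pullback[OF diff])
  \<comment> \<open>The factor \<open>B ^ k\<close> is the cost of exchanging the decay at
    \<open>psi_flow t z\<close> for decay at \<open>z\<close>.\<close>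
  define A where "A = (2 * pi + 1) * B * C * B ^ k"
  have A: "A \<ge> 0"
    using B(1) C(1) by (simp add: A_def)
  have bound: "norm (g z l - F z) \<le> A / (1 + norm z) ^ d * \<bar>l\<bar>" if l: "\<bar>l\<bar> \<le> 1" for l z
  proof -
    obtain p q r w p' q' r' w' where z: "z = (p, q, r, w, p', q', r', w')"
      by (metis prod_cases7 surj_pair)
    show ?thesis
    proof (cases "(r, w, r', w') \<in> S")
      case False
      \<comment> \<open>The flow fixes \<open>r, w, r', w'\<close>, so it cannot bring a point into
        the support of \<open>F\<close> from outside \<open>S\<close>.\<close>
      then have "F z = 0" "g z l = 0"
        using S(2) by (simp_all add: z g_def psi_flow_def)
      then show ?thesis
        using A by simp
    next
      case True
      define N where "N = 1 + norm z"
      have N: "N \<ge> 1"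
        by (simp add: N_def)
      have g'_le: "norm (g' z t) \<le> A / N ^ d" if t: "\<bar>t\<bar> \<le> 1" for t
      proof -
        define Y where "Y = 1 + norm (psi_flow t z)"
        note bds = B(2)[OF z t R[OF True]]
        have Y: "Y \<ge> 1"
          by (simp add: Y_def)
        have NY: "N \<le> B * Y"
          using bds B(1) by (simp add: N_def Y_def distrib_left)
        have vel: "norm (psi_velocity t z) \<le> B * N\<^sup>2"
        proof -
          have "norm z \<le> N\<^sup>2"
            using N power_increasing[of 1 2 N] by (simp add: N_def)
          then show ?thesis
            using bds mult_left_mono[of "norm z" "N\<^sup>2" B] B(1) by linarith
        qed
        have ang: "\<bar>psi_angle' t z\<bar> \<le> B * N\<^sup>2"
        proof -
          have "(norm z)\<^sup>2 \<le> N\<^sup>2"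
            by (intro power_mono) (auto simp: N_def)
          then show ?thesis
            using bds mult_left_mono[of "(norm z)\<^sup>2" "N\<^sup>2" B] B(1) by linarith
        qed
        have "norm (g' z t) \<le> 2 * pi * \<bar>psi_angle' t z\<bar> * norm (F (psi_flow t z))
            + norm (frechet_derivative F (at (psi_flow t z)) (psi_velocity t z))"
          unfolding g'_def norm_mult norm_e mult_1_left
          by (rule order_trans[OF norm_triangle_ineq]) (simp add: norm_mult)
        then have "Y ^ k * norm (g' z t) \<le> Y ^ k * (2 * pi * \<bar>psi_angle' t z\<bar> * norm (F (psi_flow t z))
            + norm (frechet_derivative F (at (psi_flow t z)) (psi_velocity t z)))"
          using Y by (intro mult_left_mono) auto
        also have "\<dots> = 2 * pi * \<bar>psi_angle' t z\<bar> * (Y ^ k * norm (F (psi_flow t z)))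
            + Y ^ k * norm (frechet_derivative F (at (psi_flow t z)) (psi_velocity t z))"
          by (simp add: algebra_simps)
        also have "\<dots> \<le> 2 * pi * (B * N\<^sup>2) * C + C * (B * N\<^sup>2)"
        proof (rule add_mono)
          show "2 * pi * \<bar>psi_angle' t z\<bar> * (Y ^ k * norm (F (psi_flow t z))) \<le> 2 * pi * (B * N\<^sup>2) * C"
            using C(2)[of "psi_flow t z"] ang C(1) B(1) Y
            by (intro mult_mono) (auto simp: Y_def)
          show "Y ^ k * norm (frechet_derivative F (at (psi_flow t z)) (psi_velocity t z)) \<le> C * (B * N\<^sup>2)"
            using C(3)[of "psi_flow t z" "psi_velocity t z"] mult_left_mono[OF vel C(1)]
            by (simp add: Y_def)
        qed
        also have "\<dots> = (2 * pi + 1) * B * C * N\<^sup>2"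
          by (simp add: algebra_simps)
        finally have 1: "Y ^ k * norm (g' z t) \<le> (2 * pi + 1) * B * C * N\<^sup>2" .
        have "N ^ k * norm (g' z t) \<le> (B * Y) ^ k * norm (g' z t)"
          using NY N by (intro mult_right_mono power_mono) auto
        also have "\<dots> = B ^ k * (Y ^ k * norm (g' z t))"
          by (simp add: power_mult_distrib)
        also have "\<dots> \<le> B ^ k * ((2 * pi + 1) * B * C * N\<^sup>2)"
          using B(1) by (intro mult_left_mono 1) auto
        finally have "N ^ d * norm (g' z t) * N\<^sup>2 \<le> A * N\<^sup>2"
          by (simp add: A_def k_def power_add power2_eq_square mult_ac)
        then have "N ^ d * norm (g' z t) \<le> A"
          using N by (simp add: mult_le_cancel_right)
        then show ?thesis
          using N by (simp add: pos_le_divide_eq mult.commute)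
      qed
      \<comment> \<open>The bound on \<open>g'\<close> holds on a convex set containing both 0 and
        \<open>l\<close>, as the mean value inequality demands; at 0 the pullback is
        \<open>F z\<close>.\<close>
      have "onorm (\<lambda>h. h *\<^sub>R g' z t) \<le> A / N ^ d" if "t \<in> {-1..1}" for t
      proof (rule onorm_le)
        fix h :: real
        have "\<bar>t\<bar> \<le> 1"
          using that by (simp add: abs_le_iff)
        from mult_right_mono[OF g'_le[OF this], of "norm h"]
        show "norm (h *\<^sub>R g' z t) \<le> A / N ^ d * norm h"
          by (simp only: norm_scaleR real_norm_def mult.commute abs_ge_zero)
      qed
      then have "norm (g z l - g z 0) \<le> A / N ^ d * norm (l - 0)"
        using l by (intro differentiable_bound[where S = "{-1..1}"])
          (auto intro: has_derivative_at_withinI[OF deriv] simp: abs_le_iff)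
      then show ?thesis
        by (simp add: g_def N_def)
    qed
  qed
  then show ?thesis
    using that unfolding g_def d_def by blast
qed

text \<open>For nonzero \<open>l\<close> the operator is the pullback \<open>g\<close>, whose value
  at 0 is \<open>F z\<close>, so the limit is the derivative of \<open>g\<close> at 0.\<close>

lemma Psi_difference_quotient_tendsto:
  fixes F :: "'n::finite vars \<Rightarrow> complex"
  assumes "schwartz F" and X: "X \<longlonglongrightarrow> 0" "\<And>n. X n \<noteq> 0"
  shows "(\<lambda>n. (Psi (X n) F z - F z) / complex_of_real (X n)) \<longlonglongrightarrow> - 2 * pi * \<i> * psi_bracket F z"
proof -
  have diff: "F differentiable (at x)" for x
    using assms(1) by (rule schwartz_differentiable)
  obtain M where M: "\<And>x. norm (F x) \<le> M"
    using schwartz_decay[OF assms(1), of 0] by (metis mult_1 power_0)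
  define D where "D = frechet_derivative F (at z)"
  have D: "(F has_derivative D) (at z)"
    using diff unfolding D_def by (simp add: frechet_derivative_works)
  have "continuous_on UNIV F"
    using diff by (intro differentiable_imp_continuous_on) (simp add: differentiable_on_def)
  then have psi: "psi_bracket F z = psi_phase z * F z + \<i> / (2 * pi) * D (psi_field z)"
    by (rule psi_bracket_eq[OF _ M D])
  define g where "g l = e (psi_angle l z) * F (psi_flow l z)" for l
  have "(g has_derivative (\<lambda>h. h *\<^sub>R (2 * pi * \<i> * psi_angle' 0 z * F z + D (psi_velocity 0 z)))) (at 0)"
    using has_derivative_flow_pullback[OF diff, of z 0] by (simp add: g_def[abs_def] D_def)
  \<comment> \<open>The angle has derivative \<open>- psi_phase z\<close> at 0, and
    \<open>- 2 * pi * \<i>\<close> times \<open>\<i> / (2 * pi)\<close> is 1, so both orders of the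
    bracket match.\<close>
  also have "2 * pi * \<i> * psi_angle' 0 z * F z + D (psi_velocity 0 z) = - 2 * pi * \<i> * psi_bracket F z"
    by (simp add: psi psi_angle'_0 psi_velocity_0 field_simps)
  finally have "(\<lambda>n. (g (X n *\<^sub>R 1) - g 0) /\<^sub>R X n) \<longlonglongrightarrow> 1 *\<^sub>R (- 2 * pi * \<i> * psi_bracket F z)"
    by (rule has_derivative_scaled_quotient_tendsto[OF _ X])
  then show ?thesis
    using X(2) by (simp add: g_def Psi_eq_flow scaleR_conv_of_real divide_inverse mult.commute)
qed

theorem proposition6p7:
  fixes F :: "'n::finite vars \<Rightarrow> complex"
  assumes "schwartz F"
    and "compact_support_rw F"
  shows "((\<lambda>l::real. L1_norm (\<lambda>z. (Psi l F z - F z) / complex_of_real l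
                                 - (- 2 * pi * \<i>) * psi_bracket F z)) \<longlongrightarrow> 0) (at 0)"
  unfolding tendsto_at_iff_sequentially
proof (intro allI impI)
  fix X :: "nat \<Rightarrow> real"
  assume "\<forall>n. X n \<in> UNIV - {0}" and X0: "X \<longlonglongrightarrow> 0"
  then have Xnz: "X n \<noteq> 0" for n
    by simp
  \<comment> \<open>The domination holds only for parameters of absolute value at most 1, so
    finitely many terms are discarded; \<open>LIMSEQ_offset\<close> restores them at the
    end.\<close>
  obtain m where m: "\<And>n. n \<ge> m \<Longrightarrow> \<bar>X n\<bar> < 1"
    using LIMSEQ_D[OF X0, of 1] by auto
  define Y where "Y n = X (n + m)" for n
  have Y: "Y n \<noteq> 0" "\<bar>Y n\<bar> \<le> 1" "Y \<longlonglongrightarrow> 0" for n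
    using Xnz m[of "n + m"] LIMSEQ_ignore_initial_segment[OF X0, of m] by (auto simp: Y_def[abs_def])
  obtain C where C: "\<And>l z. \<bar>l\<bar> \<le> 1 \<Longrightarrow>
    norm (e (psi_angle l z) * F (psi_flow l z) - F z) \<le> C / (1 + norm z) ^ (2 * DIM('n vars)) * \<bar>l\<bar>"
    using pullback_derivative_decay[OF assms] by blast
  have diff: "F differentiable (at x)" for x
    using assms(1) by (rule schwartz_differentiable)
  then have cont: "continuous_on UNIV F"
    by (intro differentiable_imp_continuous_on) (simp add: differentiable_on_def)
  define u where "u n z = (Psi (Y n) F z - F z) / complex_of_real (Y n)" for n z
  define u' where "u' z = - 2 * pi * \<i> * psi_bracket F z" for z
  have lim: "(\<lambda>n. u n z) \<longlonglongrightarrow> u' z" for z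
    unfolding u_def u'_def by (rule Psi_difference_quotient_tendsto[OF assms(1) Y(3) Y(1)])
  have u_meas: "u n \<in> borel_measurable lborel" for n
  proof -
    have "continuous_on UNIV (\<lambda>z. psi_angle (Y n) (z :: 'n vars))"
      unfolding psi_angle_def case_prod_unfold by (intro continuous_intros)
    moreover have "continuous_on UNIV (\<lambda>z. psi_flow (Y n) (z :: 'n vars))"
      unfolding psi_flow_def case_prod_unfold by (intro continuous_intros)
    ultimately have "continuous_on UNIV (\<lambda>z. e (psi_angle (Y n) z) * F (psi_flow (Y n) z))"
      by (intro continuous_on_mult continuous_on_e continuous_on_compose2[OF cont _ subset_UNIV])
    then have "continuous_on UNIV (\<lambda>z. Psi (Y n) F z)"
      using Y(1) by (simp add: Psi_eq_flow)
    then have "continuous_on UNIV (u n)"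
      unfolding u_def[abs_def] using Y(1) by (intro continuous_intros cont) auto
    then show ?thesis
      by (simp add: borel_measurable_continuous_onI)
  qed
  have "(\<lambda>n. \<integral>\<^sup>+z. ennreal (norm (u' z - u n z)) \<partial>lborel) \<longlonglongrightarrow> 0"
  proof (rule nn_integral_dominated_convergence_norm)
    \<comment> \<open>Measurability of the bracket is inherited from the continuous quotients as
      their pointwise limit.\<close>
    show "u' \<in> borel_measurable lborel"
      using lim by (intro borel_measurable_LIMSEQ_metric[OF u_meas]) auto
    show "AE z in lborel. norm (u n z) \<le> C / (1 + norm z) ^ (2 * DIM('n vars))" for n
    proof (rule AE_I2)
      fix z
      \<comment> \<open>The factor \<open>\<bar>l\<bar>\<close> in the decay estimate cancels the
        denominator of the quotient.\<close>
      show "norm (u n z) \<le> C / (1 + norm z) ^ (2 * DIM('n vars))"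
        using C[OF Y(2), of n z] Y(1)[of n] by (simp add: u_def Psi_eq_flow norm_divide pos_divide_le_eq)
    qed
    show "(\<integral>\<^sup>+z. ennreal (C / (1 + norm z) ^ (2 * DIM('n vars))) \<partial>(lborel :: 'n vars measure)) < \<infinity>"
      by (rule nn_integral_polynomial_decay_finite)
  qed (use u_meas lim in auto)
  then have "(\<lambda>n. L1_norm (\<lambda>z. u n z - u' z)) \<longlonglongrightarrow> 0"
    by (simp only: L1_norm_def norm_minus_commute)
  then have "(\<lambda>n. ((\<lambda>l. L1_norm (\<lambda>z. (Psi l F z - F z) / complex_of_real l
      - (- 2 * pi * \<i>) * psi_bracket F z)) \<circ> X) (n + m)) \<longlonglongrightarrow> 0"
    by (simp only: u_def u'_def Y_def o_def)
  then show "((\<lambda>l. L1_norm (\<lambda>z. (Psi l F z - F z) / complex_of_real l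
      - (- 2 * pi * \<i>) * psi_bracket F z)) \<circ> X) \<longlonglongrightarrow> 0"
    by (rule LIMSEQ_offset)
qed

end
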